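(* Let $\mathbf{X}=(X_t)_{t\in\mathbb{R}}=SMPR(\{\alpha_n\},\mu)$. Let $\nu=\int x\,d\mu(x)$ and let $m_j=\int (x-\nu)^j\,d\mu(x)$ denote the central moments of $\mu$. Then for every $\tau\in\mathbb{R}$, as $t\downarrow 0$, $$E(X_\tau-X_{\tau+t})^4=t\,\frac{\alpha_1(8m_4m_2-6m_3^2)-6\alpha_2(m_2m_4-m_3^2-m_2^3)}{m_2}+O(t^2).$$ Consequently, the process $\mathbf{X}$ allows a continuous path modification if $$\frac{4m_4m_2-3m_3^2}{3(m_4m_2-m_3^2-m_2^3)}>0\quad\text{and}\quad \alpha_2=\alpha_1\,\frac{4m_4m_2-3m_3^2}{3(m_4m_2-m_3^2-m_2^3)}.$$ Moreover, in terms of the excess kurtosis $\kappa=m_4/m_2^2-3$ and the skewness $s=m_3/m_2^{3/2}$ of $\mu$, the last equality takes the form $$\alpha_2=\alpha_1\,\frac{12+4\kappa-3s^2}{6+3\kappa-3s^2}.$$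
   Context: Throughout, $\mu$ is a probability measure on $\mathbb{R}$ with infinite support, all of whose moments are finite, and which is uniquely determined by its moments. $\{h_n\}_{n\ge 0}$ are the polynomials ($\deg h_n=n$, $h_0=1$) orthonormal in $L_2(\mu)$: $\int h_ih_j\,d\mu=\delta_{ij}$; they form an orthonormal basis of $L_2(\mu)$. $\mathbf{X}=(X_t)_{t\in\mathbb{R}}=SMPR(\{\alpha_n\},\mu)$ (with $\alpha_0=0$ and $\alpha_n>0$ for $n\ge1$) means that $\mathbf{X}$ is a real stationary Markov process with marginal distribution $X_t\sim\mu$ for every $t$, whose transition distribution $\eta(dx\,|\,y,t)=P(X_{\tau+t}\in dx\,|\,X_\tau=y)$, $t>0$, depends only on the time increment $t$, is absolutely continuous with respect to $\mu$ with $\int (d\eta/d\mu)^2d\mu<\infty$, and satisfies $$\frac{d\eta}{d\mu}(x\,|\,y,t)=\sum_{n\ge0}e^{-\alpha_nt}h_n(x)h_n(y).$$ In particular, with $\mathcal{F}_{\le\tau}=\sigma(X_r:r\le\tau)$, one has $E(h_n(X_{\tau+t})\,|\,\mathcal{F}_{\le\tau})=e^{-\alpha_nt}h_n(X_\tau)$ a.s. for all $n\ge 0$, $t>0$, and hence every conditional moment $E(X_{\tau+t}^n|\mathcal{F}_{\le \tau})$ is a polynomial of degree at most $n$ in $X_\tau$. "$\mathbf{X}$ allows a continuous path modification" means that there is a process $\tilde{\mathbf{X}}$ with continuous paths such that $P(X_t=\tilde X_t)=1$ for every $t$. *)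

theory Defs
  imports "HOL-Probability.Probability" "HOL-Computational_Algebra.Polynomial"
begin

definition measure_support :: "'a::topological_space measure \<Rightarrow> 'a set" where
  "measure_support \<mu> = {x. \<forall>U. open U \<and> x \<in> U \<longrightarrow> 0 < emeasure \<mu> U}"

definition moment_determinate :: "real measure \<Rightarrow> bool" where
  "moment_determinate \<mu> \<longleftrightarrow>
     (\<forall>\<rho>. real_distribution \<rho> \<and>
          (\<forall>n::nat. integrable \<rho> (\<lambda>x. x ^ n) \<and> (\<integral>x. x ^ n \<partial>\<rho>) = (\<integral>x. x ^ n \<partial>\<mu>))
          \<longrightarrow> \<rho> = \<mu>)"

definition admissible_marginal :: "real measure \<Rightarrow> bool" where
  "admissible_marginal \<mu> \<longleftrightarrow>
     real_distribution \<mu> \<and> infinite (measure_support \<mu>) \<and>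
     (\<forall>n::nat. integrable \<mu> (\<lambda>x. x ^ n)) \<and> moment_determinate \<mu>"

definition orthonormal_polynomials :: "real measure \<Rightarrow> (nat \<Rightarrow> real poly) \<Rightarrow> bool" where
  "orthonormal_polynomials \<mu> h \<longleftrightarrow>
     h 0 = 1 \<and> (\<forall>n. degree (h n) = n) \<and>
     (\<forall>i j. (\<integral>x. poly (h i) x * poly (h j) x \<partial>\<mu>) = (if i = j then 1 else 0))"

definition central_moment :: "real measure \<Rightarrow> nat \<Rightarrow> real" where
  "central_moment \<mu> j = (\<integral>x. (x - (\<integral>y. y \<partial>\<mu>)) ^ j \<partial>\<mu>)"

definition excess_kurtosis :: "real measure \<Rightarrow> real" where
  "excess_kurtosis \<mu> = central_moment \<mu> 4 / (central_moment \<mu> 2)\<^sup>2 - 3"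

definition skewness :: "real measure \<Rightarrow> real" where
  "skewness \<mu> = central_moment \<mu> 3 / central_moment \<mu> 2 powr (3 / 2)"

definition past_algebra :: "'a measure \<Rightarrow> (real \<Rightarrow> 'a \<Rightarrow> real) \<Rightarrow> real \<Rightarrow> 'a measure" where
  "past_algebra M X \<tau> =
     sigma (space M) {X r -` A \<inter> space M | r A. r \<le> \<tau> \<and> A \<in> sets borel}"

definition present_algebra :: "'a measure \<Rightarrow> (real \<Rightarrow> 'a \<Rightarrow> real) \<Rightarrow> real \<Rightarrow> 'a measure" where
  "present_algebra M X \<tau> = vimage_algebra (space M) (X \<tau>) borel"

definition stationary_process :: "'a measure \<Rightarrow> (real \<Rightarrow> 'a \<Rightarrow> real) \<Rightarrow> bool" where
  "stationary_process M X \<longleftrightarrow>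
     (\<forall>J s. finite J \<longrightarrow>
        distr M (PiM J (\<lambda>_. borel)) (\<lambda>\<omega>. \<lambda>r\<in>J. X (r + s) \<omega>) =
        distr M (PiM J (\<lambda>_. borel)) (\<lambda>\<omega>. \<lambda>r\<in>J. X r \<omega>))"

definition markov_process :: "'a measure \<Rightarrow> (real \<Rightarrow> 'a \<Rightarrow> real) \<Rightarrow> bool" where
  "markov_process M X \<longleftrightarrow>
     (\<forall>\<tau> t. \<forall>A\<in>sets borel. 0 < t \<longrightarrow>
        (AE \<omega> in M.
           real_cond_exp M (past_algebra M X \<tau>) (\<lambda>\<omega>. indicat_real A (X (\<tau> + t) \<omega>)) \<omega> =
           real_cond_exp M (present_algebra M X \<tau>) (\<lambda>\<omega>. indicat_real A (X (\<tau> + t) \<omega>)) \<omega>))"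

text \<open>
  The measure \<open>\<eta> t y\<close> is a regular version of the conditional distribution of \<open>X (\<tau> + t)\<close>
  given \<open>X \<tau> = y\<close>, the same for all \<open>\<tau>\<close>.
\<close>

definition transition_distribution ::
    "'a measure \<Rightarrow> (real \<Rightarrow> 'a \<Rightarrow> real) \<Rightarrow> (real \<Rightarrow> real \<Rightarrow> real measure) \<Rightarrow> bool" where
  "transition_distribution M X \<eta> \<longleftrightarrow>
     (\<forall>t>0. \<eta> t \<in> borel \<rightarrow>\<^sub>M prob_algebra borel) \<and>
     (\<forall>\<tau> t. \<forall>A\<in>sets borel. 0 < t \<longrightarrow>
        (AE \<omega> in M.
           real_cond_exp M (present_algebra M X \<tau>) (\<lambda>\<omega>. indicat_real A (X (\<tau> + t) \<omega>)) \<omega> =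
           measure (\<eta> t (X \<tau> \<omega>)) A))"

text \<open>
  A transition distribution is determined only up to a \<open>\<mu>\<close>-null set of starting points \<open>y\<close>,
  so the conditions on it are imposed for \<open>\<mu>\<close>-almost every \<open>y\<close>. The expansion of the density
  \<open>d\<eta>/d\<mu>\<close> (as a function of the end point \<open>x\<close>) in the orthonormal polynomials
  is understood as convergence in \<open>L\<^sub>2(\<mu>)\<close>.
\<close>

definition has_polynomial_expansion ::
    "real measure \<Rightarrow> (nat \<Rightarrow> real poly) \<Rightarrow> (nat \<Rightarrow> real) \<Rightarrow> (real \<Rightarrow> real \<Rightarrow> real measure) \<Rightarrow> bool" where
  "has_polynomial_expansion \<mu> h \<alpha> \<eta> \<longleftrightarrow>
     (\<forall>t>0. AE y in \<mu>.
        absolutely_continuous \<mu> (\<eta> t y) \<and>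
        (\<integral>\<^sup>+x. (RN_deriv \<mu> (\<eta> t y) x)\<^sup>2 \<partial>\<mu>) < \<infinity> \<and>
        (\<lambda>N. \<integral>x. (enn2real (RN_deriv \<mu> (\<eta> t y) x)
                   - (\<Sum>n<N. exp (- \<alpha> n * t) * poly (h n) x * poly (h n) y))\<^sup>2 \<partial>\<mu>)
          \<longlonglongrightarrow> 0)"

definition SMPR ::
    "'a measure \<Rightarrow> (real \<Rightarrow> 'a \<Rightarrow> real) \<Rightarrow> (nat \<Rightarrow> real) \<Rightarrow> real measure \<Rightarrow> (nat \<Rightarrow> real poly) \<Rightarrow> bool" where
  "SMPR M X \<alpha> \<mu> h \<longleftrightarrow>
     prob_space M \<and>
     (\<forall>t. X t \<in> borel_measurable M) \<and>
     \<alpha> 0 = 0 \<and> (\<forall>n\<ge>1. 0 < \<alpha> n) \<and>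
     stationary_process M X \<and> markov_process M X \<and>
     (\<forall>t. distr M borel (X t) = \<mu>) \<and>
     (\<exists>\<eta>. transition_distribution M X \<eta> \<and> has_polynomial_expansion \<mu> h \<alpha> \<eta>)"

definition allows_continuous_modification :: "'a measure \<Rightarrow> (real \<Rightarrow> 'a \<Rightarrow> real) \<Rightarrow> bool" where
  "allows_continuous_modification M X \<longleftrightarrow>
     (\<exists>Y. (\<forall>t. Y t \<in> borel_measurable M) \<and>
          (\<forall>\<omega>\<in>space M. continuous_on UNIV (\<lambda>t. Y t \<omega>)) \<and>
          (\<forall>t::real. AE \<omega> in M. X t \<omega> = (Y t \<omega> :: real)))"

end

theory Submission
  imports Defs
begin

text \<open>
  The transition density acts on polynomials diagonally in the basis \<open>h\<close>:
  integrating \<open>h n\<close> against \<open>\<eta> t y\<close> gives the \<open>L\<^sub>2\<close> coefficient \<open>exp (- \<alpha> n * t) * poly (h n) y\<close>.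
  Hence every mixed moment of \<open>X \<tau>\<close> and \<open>X (\<tau> + t)\<close> is a finite combination of the \<open>exp (- \<alpha> k * t)\<close>.
  For the fourth moment of the increment only \<open>k \<le> 2\<close> contributes, because the centred coordinate is
  a multiple of \<open>h 1\<close>. The stated relation between \<open>\<alpha> 1\<close> and \<open>\<alpha> 2\<close> kills the linear term, so
  the fourth moment is quadratic in \<open>t\<close> and the Kolmogorov continuity criterion applies.
\<close>

text \<open>The second moment of an increment is 2 m2 (1 - exp(- \<alpha>1 t)), of exact order t,
  while the criterion demands an exponent above 1. Hence the fourth moment: cancelling its linear
  term leaves exponent 2. The constants come from the square of the centred coordinate. Its squared
  coefficient along \<open>h 1\<close> is m3^2/m2, and Parseval leaves m4 - m2^2 - m3^2/m2 along
  \<open>h 2\<close>; so the denominator of the critical ratio is 3 m2 times a square. The analytic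
  obstacle is that the density expansion converges only in L2, and only for almost every starting
  point, so there is no pointwise series to integrate against an unbounded polynomial. Pairing with
  a fixed \<open>h n\<close> is continuous in L2, so single coefficients can still be read off; from
  there on all sums are finite.\<close>

subsection \<open>The Kolmogorov continuity criterion\<close>

text \<open>Borel-Cantelli in terms of expectations: the series of the \<open>u n\<close> has finite
  integral, so it converges almost everywhere and its terms vanish. The shift by \<open>N\<close>
  discards the early terms, whose integrals may be infinite.\<close>

lemma AE_tendsto_zero_of_summable_nn_integral:
  fixes u :: "nat \<Rightarrow> 'a \<Rightarrow> real"
  assumes [measurable]: "\<And>n. u n \<in> borel_measurable M"
    and nonneg: "\<And>n x. 0 \<le> u n x"
    and bound: "\<forall>\<^sub>F n in sequentially. (\<integral>\<^sup>+x. ennreal (u n x) \<partial>M) \<le> ennreal (b n)"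
    and "summable b" and b_nonneg: "\<And>n. 0 \<le> b n"
  shows "AE x in M. (\<lambda>n. u n x) \<longlonglongrightarrow> 0"
proof -
  obtain N where N: "\<And>n. n \<ge> N \<Longrightarrow> (\<integral>\<^sup>+x. ennreal (u n x) \<partial>M) \<le> ennreal (b n)"
    using bound by (auto simp: eventually_sequentially)
  have "(\<integral>\<^sup>+x. (\<Sum>n. ennreal (u (n + N) x)) \<partial>M) = (\<Sum>n. \<integral>\<^sup>+x. ennreal (u (n + N) x) \<partial>M)"
    by (intro nn_integral_suminf) auto
  also have "\<dots> \<le> (\<Sum>n. ennreal (b (n + N)))"
    by (intro suminf_le N) auto
  also have "\<dots> = ennreal (\<Sum>n. b (n + N))"
    using assms by (intro suminf_ennreal2) (auto simp: summable_iff_shift)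
  also have "\<dots> < \<infinity>"
    by simp
  finally have "AE x in M. (\<Sum>n. ennreal (u (n + N) x)) \<noteq> \<infinity>"
    by (intro nn_integral_noteq_infinite) auto
  thus ?thesis
  proof eventually_elim
    case (elim x)
    hence "summable (\<lambda>n. u (n + N) x)"
      using nonneg by (intro summable_suminf_not_top) auto
    hence "(\<lambda>n. u (n + N) x) \<longlonglongrightarrow> 0"
      by (rule summable_LIMSEQ_zero)
    thus ?case
      by (rule LIMSEQ_offset)
  qed
qed

section \<open>Dyadic grids and chaining\<close>

definition dyadic_floor :: "nat \<Rightarrow> real \<Rightarrow> real" where
  "dyadic_floor n t = of_int \<lfloor>2 ^ n * t\<rfloor> / 2 ^ n"

lemma dyadic_floor_error: "0 \<le> t - dyadic_floor n t" "t - dyadic_floor n t < 1 / 2 ^ n"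
proof -
  have "t - dyadic_floor n t = (2 ^ n * t - of_int \<lfloor>2 ^ n * t\<rfloor>) / 2 ^ n"
    by (simp add: dyadic_floor_def diff_divide_distrib)
  moreover have "0 \<le> 2 ^ n * t - of_int \<lfloor>2 ^ n * t\<rfloor>" "2 ^ n * t - of_int \<lfloor>2 ^ n * t\<rfloor> < 1"
    by linarith+
  ultimately show "0 \<le> t - dyadic_floor n t" "t - dyadic_floor n t < 1 / 2 ^ n"
    by (auto intro: divide_strict_right_mono)
qed

text \<open>A Hoelder condition on the grid of mesh 2^(-n): for 0 < c < 1, \<open>c ^ n\<close> is
  the mesh raised to the power - log2 c.\<close>

definition small_dyadic_increments :: "real \<Rightarrow> (real \<Rightarrow> real) \<Rightarrow> nat \<Rightarrow> bool" where
  "small_dyadic_increments c x n \<longleftrightarrow>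
     (\<forall>j\<in>{- int n * 2 ^ n..int n * 2 ^ n}. \<bar>x (of_int (j + 1) / 2 ^ n) - x (of_int j / 2 ^ n)\<bar> \<le> c ^ n)"

lemma floor_dyadic_bounds:
  assumes "\<bar>t\<bar> \<le> real n"
  shows "\<lfloor>2 ^ n * t\<rfloor> \<in> {- int n * 2 ^ n..int n * 2 ^ n}"
proof -
  have "2 ^ n * t \<le> 2 ^ n * real n" "2 ^ n * (- real n) \<le> 2 ^ n * t"
    using assms by (intro mult_left_mono; simp)+
  hence "2 ^ n * t \<le> of_int (int n * 2 ^ n)" "of_int (- int n * 2 ^ n) \<le> 2 ^ n * t"
    by (auto simp: mult.commute)
  thus ?thesis
    unfolding atLeastAtMost_iff by linarith
qed

text \<open>Halving the mesh either keeps the grid point below \<open>t\<close> or moves it one fine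
  step to the right, so a single increment of level \<open>Suc n\<close> covers the change.\<close>

lemma small_dyadic_increments_refine:
  assumes "small_dyadic_increments c x (Suc n)" "\<bar>t\<bar> \<le> real n" "0 \<le> c"
  shows "\<bar>x (dyadic_floor (Suc n) t) - x (dyadic_floor n t)\<bar> \<le> c ^ Suc n"
proof -
  let ?k = "\<lfloor>2 ^ n * t\<rfloor>"
  have "?k \<in> {- int n * 2 ^ n..int n * 2 ^ n}"
    using assms(2) by (rule floor_dyadic_bounds)
  hence "2 * ?k \<in> {- int (Suc n) * 2 ^ Suc n..int (Suc n) * 2 ^ Suc n}"
  proof -
    have "int (Suc n) * 2 ^ Suc n = 2 * (int n * 2 ^ n) + 2 * 2 ^ n" "(0::int) \<le> 2 ^ n"
      by (simp_all add: algebra_simps)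
    with \<open>?k \<in> _\<close> show ?thesis
      unfolding atLeastAtMost_iff mult_minus_left by linarith
  qed
  hence incr: "\<bar>x (of_int (2 * ?k + 1) / 2 ^ Suc n) - x (of_int (2 * ?k) / 2 ^ Suc n)\<bar> \<le> c ^ Suc n"
    using assms(1) unfolding small_dyadic_increments_def by blast
  have eq: "of_int (2 * ?k) / 2 ^ Suc n = dyadic_floor n t"
    by (simp add: dyadic_floor_def)
  have "\<lfloor>2 ^ Suc n * t\<rfloor> = 2 * ?k \<or> \<lfloor>2 ^ Suc n * t\<rfloor> = 2 * ?k + 1"
    by simp linarith
  thus ?thesis
  proof
    assume "\<lfloor>2 ^ Suc n * t\<rfloor> = 2 * ?k"
    hence "dyadic_floor (Suc n) t = dyadic_floor n t"
      using eq by (simp add: dyadic_floor_def)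
    thus ?thesis using assms(3) by simp
  next
    assume "\<lfloor>2 ^ Suc n * t\<rfloor> = 2 * ?k + 1"
    hence "dyadic_floor (Suc n) t = of_int (2 * ?k + 1) / 2 ^ Suc n"
      by (simp add: dyadic_floor_def)
    thus ?thesis using incr eq by simp
  qed
qed

text \<open>Times at most one mesh apart lie in the same cell or in adjacent ones. Increments are
  indexed by their left end point, so the window condition concerns \<open>s\<close>.\<close>

lemma small_dyadic_increments_near:
  assumes "small_dyadic_increments c x n" "\<bar>s\<bar> \<le> real n" "s \<le> t" "t - s \<le> 1 / 2 ^ n" "0 \<le> c"
  shows "\<bar>x (dyadic_floor n t) - x (dyadic_floor n s)\<bar> \<le> c ^ n"
proof -
  have "2 ^ n * t \<le> 2 ^ n * s + 1" "2 ^ n * s \<le> 2 ^ n * t"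
    using assms by (auto simp: field_simps)
  hence "\<lfloor>2 ^ n * t\<rfloor> = \<lfloor>2 ^ n * s\<rfloor> \<or> \<lfloor>2 ^ n * t\<rfloor> = \<lfloor>2 ^ n * s\<rfloor> + 1"
    by linarith
  thus ?thesis
    using assms(1,5) floor_dyadic_bounds[OF assms(2)]
    by (auto simp: dyadic_floor_def small_dyadic_increments_def)
qed

text \<open>The limit is a telescoping series along the levels from \<open>n\<close> on, dominated
  by a geometric series of ratio \<open>c\<close>. Once \<open>t\<close> lies in the window of level
  \<open>n\<close>, it lies in all later ones.\<close>

lemma dyadic_limit_error:
  assumes small: "\<And>n. n \<ge> N \<Longrightarrow> small_dyadic_increments c x n"
    and c: "0 \<le> c" "c < 1" and n: "n \<ge> N" "\<bar>t\<bar> \<le> real n"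
  shows "convergent (\<lambda>k. x (dyadic_floor k t))"
    and "\<bar>lim (\<lambda>k. x (dyadic_floor k t)) - x (dyadic_floor n t)\<bar> \<le> c ^ n / (1 - c)"
proof -
  define d where "d = (\<lambda>k. x (dyadic_floor (Suc (k + n)) t) - x (dyadic_floor (k + n) t))"
  have d: "\<bar>d k\<bar> \<le> c ^ n * c ^ k" for k
  proof -
    have "\<bar>d k\<bar> \<le> c ^ Suc (k + n)"
      unfolding d_def using n c
      by (intro small_dyadic_increments_refine small) auto
    also have "\<dots> \<le> c ^ (k + n)"
      using c by (intro power_decreasing) auto
    finally show ?thesis by (simp add: power_add mult.commute)
  qed
  have geo: "(\<lambda>k. c ^ n * c ^ k) sums (c ^ n * (1 / (1 - c)))"
    using c by (intro sums_mult geometric_sums) auto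
  have abs_summable: "summable (\<lambda>k. \<bar>d k\<bar>)"
    by (rule summable_comparison_test'[OF sums_summable[OF geo], of 0]) (use d in auto)
  hence "summable d"
    by (rule summable_rabs_cancel)
  hence "(\<lambda>k. \<Sum>i<k. d i) \<longlonglongrightarrow> suminf d"
    by (rule summable_LIMSEQ)
  moreover have "(\<Sum>i<k. d i) = x (dyadic_floor (k + n) t) - x (dyadic_floor n t)" for k
    unfolding d_def using sum_lessThan_telescope[of "\<lambda>i. x (dyadic_floor (i + n) t)" k] by simp
  ultimately have "(\<lambda>k. x (dyadic_floor (k + n) t) - x (dyadic_floor n t) + x (dyadic_floor n t))
      \<longlonglongrightarrow> suminf d + x (dyadic_floor n t)"
    by (intro tendsto_add tendsto_const) simp
  hence "(\<lambda>k. x (dyadic_floor (k + n) t)) \<longlonglongrightarrow> suminf d + x (dyadic_floor n t)"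
    by simp
  hence L: "(\<lambda>k. x (dyadic_floor k t)) \<longlonglongrightarrow> suminf d + x (dyadic_floor n t)"
    by (rule LIMSEQ_offset)
  thus "convergent (\<lambda>k. x (dyadic_floor k t))"
    by (auto simp: convergent_def)
  have "\<bar>suminf d\<bar> \<le> (\<Sum>k. \<bar>d k\<bar>)"
    by (rule summable_rabs) (rule abs_summable)
  also have "\<dots> \<le> (\<Sum>k. c ^ n * c ^ k)"
    using d abs_summable sums_summable[OF geo] by (intro suminf_le) auto
  also have "\<dots> = c ^ n / (1 - c)"
    using sums_unique[OF geo] by simp
  finally show "\<bar>lim (\<lambda>k. x (dyadic_floor k t)) - x (dyadic_floor n t)\<bar> \<le> c ^ n / (1 - c)"
    using limI[OF L] by simp
qed

lemma continuous_on_dyadic_limit: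
  assumes small: "\<And>n. n \<ge> N \<Longrightarrow> small_dyadic_increments c x n" and c: "0 \<le> c" "c < 1"
  shows "continuous_on UNIV (\<lambda>t. lim (\<lambda>k. x (dyadic_floor k t)))"
proof -
  define y where "y = (\<lambda>t. lim (\<lambda>k. x (dyadic_floor k t)))"
  \<comment> \<open>Two errors of passing from the limit to the grid, at \<open>s\<close> and at
    \<open>t\<close>, plus one grid increment between them.\<close>
  define B where "B = 2 / (1 - c) + 1"
  have "B > 0" using c by (simp add: B_def add_pos_pos)
  have ordered: "\<bar>y t - y s\<bar> \<le> B * c ^ n"
    if "n \<ge> N" "\<bar>s\<bar> \<le> real n" "\<bar>t\<bar> \<le> real n" "s \<le> t" "t - s \<le> 1 / 2 ^ n" for s t n
  proof -
    have "\<bar>y t - x (dyadic_floor n t)\<bar> \<le> c ^ n / (1 - c)" "\<bar>y s - x (dyadic_floor n s)\<bar> \<le> c ^ n / (1 - c)"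
      unfolding y_def using that c by (auto intro!: dyadic_limit_error(2) small)
    moreover have "\<bar>x (dyadic_floor n t) - x (dyadic_floor n s)\<bar> \<le> c ^ n"
      using that c by (intro small_dyadic_increments_near small) auto
    ultimately have "\<bar>y t - y s\<bar> \<le> c ^ n / (1 - c) + c ^ n / (1 - c) + c ^ n"
      by linarith
    thus ?thesis by (simp add: B_def algebra_simps)
  qed
  have "isCont y t" for t
    unfolding LIM_eq isCont_def
  proof (intro allI impI)
    fix e :: real assume "e > 0"
    have "(\<lambda>n. B * c ^ n) \<longlonglongrightarrow> B * 0"
      using c by (intro tendsto_mult tendsto_const LIMSEQ_realpow_zero) auto
    hence "\<forall>\<^sub>F n in sequentially. B * c ^ n < e"
      using \<open>e > 0\<close> by (auto dest: order_tendstoD)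
    \<comment> \<open>The extra 1 keeps every point within 2^(-n) of \<open>t\<close> inside the
      window as well.\<close>
    moreover have "\<forall>\<^sub>F n in sequentially. n \<ge> N \<and> \<bar>t\<bar> + 1 \<le> real n"
      using eventually_conj[OF eventually_ge_at_top[of N] eventually_ge_at_top[of "nat \<lceil>\<bar>t\<bar> + 1\<rceil>"]]
      by eventually_elim linarith
    ultimately have "\<forall>\<^sub>F n in sequentially. B * c ^ n < e \<and> n \<ge> N \<and> \<bar>t\<bar> + 1 \<le> real n"
      by eventually_elim auto
    then obtain n where n: "B * c ^ n < e" "n \<ge> N" "\<bar>t\<bar> + 1 \<le> real n"
      by (auto simp: eventually_sequentially)
    have "\<bar>y s - y t\<bar> < e" if s: "\<bar>s - t\<bar> < 1 / 2 ^ n" for s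
    proof -
      have "1 / 2 ^ n \<le> (1::real)" by simp
      hence "\<bar>s\<bar> \<le> real n" "\<bar>t\<bar> \<le> real n" using n(3) s by linarith+
      hence "\<bar>y s - y t\<bar> \<le> B * c ^ n"
        using ordered[of n s t] ordered[of n t s] n(2) s by (cases "s \<le> t") (auto simp: abs_minus_commute)
      thus ?thesis using n(1) by linarith
    qed
    thus "\<exists>r>0. \<forall>s. s \<noteq> t \<and> norm (s - t) < r \<longrightarrow> norm (y s - y t) < e"
      by (intro exI[of _ "1 / 2 ^ n"]) auto
  qed
  thus ?thesis
    by (simp add: y_def continuous_on_eq_continuous_at)
qed

text \<open>
  The modification is the pointwise limit of \<open>X\<close> along the dyadic times just below \<open>t\<close>. The chaining
  bound on dyadic increments controls only times in \<open>[-n, n]\<close> at level \<open>n\<close>, so that a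
  single almost sure event serves all of the real line.
\<close>

theorem Kolmogorov_continuity:
  fixes X :: "real \<Rightarrow> 'a \<Rightarrow> real"
  assumes [measurable]: "\<And>t. X t \<in> borel_measurable M"
    and "0 < p" "0 < \<beta>" "0 \<le> C" "0 < \<delta>"
    and bound: "\<And>s t. \<bar>s - t\<bar> < \<delta> \<Longrightarrow>
      (\<integral>\<^sup>+\<omega>. ennreal (\<bar>X s \<omega> - X t \<omega>\<bar> powr p) \<partial>M) \<le> ennreal (C * \<bar>s - t\<bar> powr (1 + \<beta>))"
  shows "allows_continuous_modification M X"
proof -
  \<comment> \<open>Half of the surplus exponent \<beta> is spent on the path bound
    \<open>c ^ n\<close>. The p-th moment of an increment divided by \<open>c ^ n\<close> is then at
    most C r^n / 2^n: the factor 2^(-n) pays for the number of grid points, and the other half,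
    \<open>r ^ n\<close>, gives summability.\<close>
  define c where "c = 2 powr (- \<beta> / (2 * p))"
  have c: "0 < c" "c < 1"
    using assms by (auto simp: c_def powr_less_one)
  define r where "r = 2 powr (- \<beta> / 2)"
  have r: "0 < r" "r < 1"
    using assms by (auto simp: r_def powr_less_one)
  have fine: "\<forall>\<^sub>F n in sequentially. 1 / 2 ^ n < \<delta>"
  proof -
    have "(\<lambda>n. (1 / 2) ^ n) \<longlonglongrightarrow> (0::real)"
      by (rule LIMSEQ_realpow_zero) auto
    hence "\<forall>\<^sub>F n in sequentially. (1 / 2) ^ n < \<delta>"
      using \<open>0 < \<delta>\<close> by (rule order_tendstoD)
    thus ?thesis by (simp add: power_divide)
  qed
  have scale: "(1 / 2 ^ n) powr (1 + \<beta>) / (c ^ n) powr p = r ^ n / 2 ^ n" for n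
  proof -
    have "(1 / 2 ^ n) powr (1 + \<beta>) = 2 powr (- real n * (1 + \<beta>))"
      by (simp add: powr_realpow powr_minus_divide powr_divide flip: powr_powr)
    moreover have "(c ^ n) powr p = 2 powr (- real n * \<beta> / 2)"
      using \<open>0 < p\<close> c(1) by (simp add: powr_powr c_def mult.commute flip: powr_realpow)
    moreover have "r ^ n / 2 ^ n = 2 powr (- real n * \<beta> / 2 - real n)"
      using r(1) by (simp add: powr_powr powr_diff r_def mult.commute flip: powr_realpow)
    ultimately show ?thesis
      by (simp add: field_simps flip: powr_diff)
  qed
  have AE_small: "AE \<omega> in M. \<forall>\<^sub>F n in sequentially. small_dyadic_increments c (\<lambda>t. X t \<omega>) n"
  proof -
    define J where "J n = {- int n * 2 ^ n..int n * 2 ^ n}" for n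
    define inc where "inc n j \<omega> = X (of_int (j + 1) / 2 ^ n) \<omega> - X (of_int j / 2 ^ n) \<omega>" for n and j :: int and \<omega>
    \<comment> \<open>A sum in place of the maximum: it can be integrated term by term, and
      \<open>u n \<omega> < 1\<close> already forces every increment of level \<open>n\<close> below
      \<open>c ^ n\<close>.\<close>
    define u where "u n \<omega> = (\<Sum>j\<in>J n. (\<bar>inc n j \<omega>\<bar> / c ^ n) powr p)" for n \<omega>
    \<comment> \<open>\<open>J n\<close> has at most 2 (n + 1) 2^n points, each contributing at most
      C r^n / 2^n. The factor n + 1 comes from the growing window; the resulting series is the
      derivative of the geometric one.\<close>
    define b where "b n = 2 * C * (real (Suc n) * r ^ n)" for n
    have "AE \<omega> in M. (\<lambda>n. u n \<omega>) \<longlonglongrightarrow> 0"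
    proof (rule AE_tendsto_zero_of_summable_nn_integral)
      show "u n \<in> borel_measurable M" for n
        unfolding u_def inc_def by measurable
      show "0 \<le> u n \<omega>" for n \<omega>
        by (simp add: u_def sum_nonneg)
      show "0 \<le> b n" for n
        using assms r by (simp add: b_def)
      show "summable b"
        unfolding b_def using geometric_deriv_sums[of r] r by (intro summable_mult) (auto dest: sums_summable)
      show "\<forall>\<^sub>F n in sequentially. (\<integral>\<^sup>+\<omega>. ennreal (u n \<omega>) \<partial>M) \<le> ennreal (b n)"
        using fine
      proof eventually_elim
        case (elim n)
        have "(\<integral>\<^sup>+\<omega>. ennreal ((\<bar>inc n j \<omega>\<bar> / c ^ n) powr p) \<partial>M) \<le> ennreal (C * (r ^ n / 2 ^ n))" for j
        proof -
          have "(\<integral>\<^sup>+\<omega>. ennreal ((\<bar>inc n j \<omega>\<bar> / c ^ n) powr p) \<partial>M)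
              = (\<integral>\<^sup>+\<omega>. ennreal (1 / (c ^ n) powr p) * ennreal (\<bar>inc n j \<omega>\<bar> powr p) \<partial>M)"
            using c by (simp add: powr_divide flip: ennreal_mult)
          also have "\<dots> = ennreal (1 / (c ^ n) powr p) * (\<integral>\<^sup>+\<omega>. ennreal (\<bar>inc n j \<omega>\<bar> powr p) \<partial>M)"
            unfolding inc_def by (intro nn_integral_cmult) measurable
          also have "\<dots> \<le> ennreal (1 / (c ^ n) powr p) * ennreal (C * (1 / 2 ^ n) powr (1 + \<beta>))"
            unfolding inc_def using bound[of "of_int (j + 1) / 2 ^ n" "of_int j / 2 ^ n"] elim
            by (intro mult_left_mono) (auto simp: add_divide_distrib)
          also have "\<dots> = ennreal (C * (r ^ n / 2 ^ n))"
            using assms by (simp add: scale[symmetric] flip: ennreal_mult)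
          finally show ?thesis .
        qed
        note term_bound = this
        have "(\<integral>\<^sup>+\<omega>. ennreal (u n \<omega>) \<partial>M) = (\<integral>\<^sup>+\<omega>. (\<Sum>j\<in>J n. ennreal ((\<bar>inc n j \<omega>\<bar> / c ^ n) powr p)) \<partial>M)"
          by (simp add: u_def)
        also have "\<dots> = (\<Sum>j\<in>J n. \<integral>\<^sup>+\<omega>. ennreal ((\<bar>inc n j \<omega>\<bar> / c ^ n) powr p) \<partial>M)"
          unfolding inc_def by (intro nn_integral_sum) measurable
        also have "\<dots> \<le> (\<Sum>j\<in>J n. ennreal (C * (r ^ n / 2 ^ n)))"
          by (intro sum_mono term_bound)
        also have "\<dots> = ennreal (real (card (J n)) * (C * (r ^ n / 2 ^ n)))"
          by (simp add: ennreal_of_nat_eq_real_of_nat flip: ennreal_mult')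
        also have "\<dots> \<le> ennreal (b n)"
        proof (rule ennreal_leI)
          have "real (card (J n)) = 2 * real n * 2 ^ n + 1"
            by (simp add: J_def nat_add_distrib nat_mult_distrib nat_power_eq)
          also have "\<dots> \<le> 2 * real (Suc n) * 2 ^ n"
          proof -
            have "2 * real (Suc n) * 2 ^ n = 2 * real n * 2 ^ n + 2 * 2 ^ n" "(1::real) \<le> 2 ^ n"
              by (simp_all add: algebra_simps)
            thus ?thesis by linarith
          qed
          finally have "real (card (J n)) * (C * (r ^ n / 2 ^ n)) \<le> 2 * real (Suc n) * 2 ^ n * (C * (r ^ n / 2 ^ n))"
            using assms r by (intro mult_right_mono) auto
          thus "real (card (J n)) * (C * (r ^ n / 2 ^ n)) \<le> b n"
            by (simp add: b_def algebra_simps)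
        qed
        finally show ?case .
      qed
    qed
    thus ?thesis
    proof eventually_elim
      case (elim \<omega>)
      hence "\<forall>\<^sub>F n in sequentially. u n \<omega> < 1"
        by (rule order_tendstoD) simp
      thus ?case
      proof eventually_elim
        case (elim n)
        have "\<bar>inc n j \<omega>\<bar> \<le> c ^ n" if "j \<in> J n" for j
        proof (rule ccontr)
          assume "\<not> \<bar>inc n j \<omega>\<bar> \<le> c ^ n"
          hence "1 \<le> (\<bar>inc n j \<omega>\<bar> / c ^ n) powr p"
            using c \<open>0 < p\<close> by (intro ge_one_powr_ge_zero) auto
          also have "\<dots> \<le> u n \<omega>"
            unfolding u_def using that by (intro member_le_sum) (auto simp: J_def)
          finally show False using elim by simp
        qed
        thus ?case
          by (simp add: small_dyadic_increments_def inc_def J_def)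
      qed
    qed
  qed
  \<comment> \<open>This null set depends on \<open>t\<close>, which a modification permits;
    continuity of the paths rests on the preceding event, which does not involve
    \<open>t\<close>.\<close>
  have AE_approx: "AE \<omega> in M. (\<lambda>n. X (dyadic_floor n t) \<omega>) \<longlonglongrightarrow> X t \<omega>" for t
  proof -
    have "AE \<omega> in M. (\<lambda>n. \<bar>X (dyadic_floor n t) \<omega> - X t \<omega>\<bar> powr p) \<longlonglongrightarrow> 0"
    proof (rule AE_tendsto_zero_of_summable_nn_integral)
      show "summable (\<lambda>n. C * (1 / 2) ^ n)"
        by (intro summable_mult summable_geometric) auto
      show "\<forall>\<^sub>F n in sequentially. (\<integral>\<^sup>+\<omega>. ennreal (\<bar>X (dyadic_floor n t) \<omega> - X t \<omega>\<bar> powr p) \<partial>M)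
          \<le> ennreal (C * (1 / 2) ^ n)"
        using fine
      proof eventually_elim
        case (elim n)
        let ?e = "\<bar>dyadic_floor n t - t\<bar>"
        have e: "?e \<le> (1 / 2) ^ n" "?e < \<delta>"
          using dyadic_floor_error[of t n] elim by (auto simp: power_divide)
        have "?e powr (1 + \<beta>) \<le> ((1 / 2) ^ n) powr (1 + \<beta>)"
          using assms e by (intro powr_mono2) auto
        also have "\<dots> \<le> ((1 / 2) ^ n) powr 1"
          using assms by (intro powr_mono') (auto simp: power_le_one)
        finally have "C * ?e powr (1 + \<beta>) \<le> C * (1 / 2) ^ n"
          using assms by (intro mult_left_mono) auto
        thus ?case
          using bound[OF e(2)] by (meson ennreal_leI order_trans)
      qed
    qed (use assms in auto)
    thus ?thesis
    proof eventually_elim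
      case (elim \<omega>)
      have "(\<lambda>n. (\<bar>X (dyadic_floor n t) \<omega> - X t \<omega>\<bar> powr p) powr (1 / p)) \<longlonglongrightarrow> 0"
        using \<open>0 < p\<close> by (intro tendsto_zero_powrI[OF elim tendsto_const]) auto
      hence "(\<lambda>n. \<bar>X (dyadic_floor n t) \<omega> - X t \<omega>\<bar>) \<longlonglongrightarrow> 0"
        using \<open>0 < p\<close> by (simp add: powr_powr)
      thus ?case
        by (simp add: tendsto_rabs_zero_iff LIM_zero_iff)
    qed
  qed
  \<comment> \<open>Only countably many dyadic times occur, so this set is measurable. The indicator
    inside the limit in \<open>Y\<close> makes the paths outside it identically 0, hence continuous
    for every \<omega>.\<close>
  define good where "good = {\<omega> \<in> space M. \<exists>N. \<forall>n\<ge>N. small_dyadic_increments c (\<lambda>t. X t \<omega>) n}"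
  have [measurable]: "good \<in> sets M"
    unfolding good_def small_dyadic_increments_def by measurable
  define Y where "Y t \<omega> = lim (\<lambda>n. indicat_real good \<omega> * X (dyadic_floor n t) \<omega>)" for t \<omega>
  have Y_good: "Y t \<omega> = lim (\<lambda>n. X (dyadic_floor n t) \<omega>)" if "\<omega> \<in> good" for t \<omega>
    using that by (simp add: Y_def)
  show ?thesis
    unfolding allows_continuous_modification_def
  proof (intro exI[of _ Y] conjI allI ballI)
    show "Y t \<in> borel_measurable M" for t
      unfolding Y_def by measurable
    show "continuous_on UNIV (\<lambda>t. Y t \<omega>)" if "\<omega> \<in> space M" for \<omega>
    proof (cases "\<omega> \<in> good")
      case True
      then obtain N where "\<And>n. n \<ge> N \<Longrightarrow> small_dyadic_increments c (\<lambda>t. X t \<omega>) n"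
        by (auto simp: good_def)
      with True show ?thesis
        using continuous_on_dyadic_limit[of N c "\<lambda>t. X t \<omega>"] c by (simp add: Y_good)
    qed (simp add: Y_def)
    show "AE \<omega> in M. X t \<omega> = Y t \<omega>" for t
      using AE_small AE_approx[of t] AE_space
    proof eventually_elim
      case (elim \<omega>)
      hence "\<omega> \<in> good"
        by (simp add: good_def eventually_sequentially)
      thus ?case
        using elim(2) by (simp add: Y_good limI)
    qed
  qed
qed

subsection \<open>Transition distributions and conditional expectations\<close>

lemma present_algebra_subalgebra:
  assumes [measurable]: "X \<tau> \<in> borel_measurable M"
  shows "subalgebra M (present_algebra M X \<tau>)"
  unfolding subalgebra_def present_algebra_def
  by (auto simp: sets_vimage_algebra2)

lemma measurable_present_algebra: "X \<tau> \<in> borel_measurable (present_algebra M X \<tau>)"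
  unfolding present_algebra_def by (rule measurable_vimage_algebra1) auto

text \<open>The kernel disintegrates the joint law of \<open>X \<tau>\<close> and
  \<open>X (\<tau> + t)\<close>, tested on rectangles. Nonnegative integrals are used so that both
  sides can be read as measures in \<open>A\<close>.\<close>

lemma emeasure_transition_distribution:
  assumes "prob_space M" and X [measurable]: "\<And>r. X r \<in> borel_measurable M"
    and trans: "transition_distribution M X \<eta>" and "0 < t"
    and [measurable]: "A \<in> sets borel" "B \<in> sets borel"
  shows "(\<integral>\<^sup>+\<omega>. indicator B (X \<tau> \<omega>) * indicator A (X (\<tau> + t) \<omega>) \<partial>M) =
    (\<integral>\<^sup>+\<omega>. indicator B (X \<tau> \<omega>) * emeasure (\<eta> t (X \<tau> \<omega>)) A \<partial>M)"
proof -
  interpret prob_space M by fact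
  interpret F: finite_measure_subalgebra M "present_algebra M X \<tau>"
    by unfold_locales (intro present_algebra_subalgebra X)
  have kernel [measurable]: "\<eta> t \<in> borel \<rightarrow>\<^sub>M prob_algebra borel"
    using trans \<open>0 < t\<close> by (auto simp: transition_distribution_def)
  have [measurable]: "\<eta> t \<in> borel \<rightarrow>\<^sub>M subprob_algebra borel"
    by (rule measurable_prob_algebraD) (rule kernel)
  have prob: "prob_space (\<eta> t y)" for y
    using measurable_space[OF kernel] by (simp add: space_prob_algebra)
  note [measurable] = measurable_present_algebra
  have AE_eq: "AE \<omega> in M. real_cond_exp M (present_algebra M X \<tau>) (\<lambda>\<omega>. indicat_real A (X (\<tau> + t) \<omega>)) \<omega> =
      measure (\<eta> t (X \<tau> \<omega>)) A"
    using trans \<open>0 < t\<close> by (auto simp: transition_distribution_def)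
  have int: "integrable M (\<lambda>\<omega>. indicat_real B (X \<tau> \<omega>) * indicat_real A (X (\<tau> + t) \<omega>))"
    by (rule integrable_const_bound[where B = 1]) (auto simp: indicator_def)
  have int': "integrable M (\<lambda>\<omega>. indicat_real B (X \<tau> \<omega>) * measure (\<eta> t (X \<tau> \<omega>)) A)"
    using prob by (intro integrable_const_bound[where B = 1]) (auto simp: indicator_def prob_space.prob_le_1)
  have "(\<integral>\<^sup>+\<omega>. indicator B (X \<tau> \<omega>) * indicator A (X (\<tau> + t) \<omega>) \<partial>M)
      = (\<integral>\<^sup>+\<omega>. ennreal (indicat_real B (X \<tau> \<omega>) * indicat_real A (X (\<tau> + t) \<omega>)) \<partial>M)"
    by (intro nn_integral_cong) (auto simp: indicator_def)
  also have "\<dots> = ennreal (\<integral>\<omega>. indicat_real B (X \<tau> \<omega>) * indicat_real A (X (\<tau> + t) \<omega>) \<partial>M)"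
    using int by (intro nn_integral_eq_integral) auto
  also have "(\<integral>\<omega>. indicat_real B (X \<tau> \<omega>) * indicat_real A (X (\<tau> + t) \<omega>) \<partial>M)
      = (\<integral>\<omega>. indicat_real B (X \<tau> \<omega>) *
          real_cond_exp M (present_algebra M X \<tau>) (\<lambda>\<omega>. indicat_real A (X (\<tau> + t) \<omega>)) \<omega> \<partial>M)"
    by (rule F.real_cond_exp_intg(2)[symmetric, OF int]) measurable
  also have "\<dots> = (\<integral>\<omega>. indicat_real B (X \<tau> \<omega>) * measure (\<eta> t (X \<tau> \<omega>)) A \<partial>M)"
    using AE_eq by (intro integral_cong_AE) auto
  also have "ennreal \<dots> = (\<integral>\<^sup>+\<omega>. ennreal (indicat_real B (X \<tau> \<omega>) * measure (\<eta> t (X \<tau> \<omega>)) A) \<partial>M)"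
    using int' by (intro nn_integral_eq_integral[symmetric]) auto
  also have "\<dots> = (\<integral>\<^sup>+\<omega>. indicator B (X \<tau> \<omega>) * emeasure (\<eta> t (X \<tau> \<omega>)) A \<partial>M)"
    using prob by (intro nn_integral_cong)
      (auto simp: indicator_def finite_measure.emeasure_eq_measure prob_space.finite_measure)
  finally show ?thesis .
qed

text \<open>For fixed \<open>B\<close> both sides integrate \<open>f\<close> against a measure: the
  law of \<open>X (\<tau> + t)\<close> under \<open>M\<close> restricted to the event that
  \<open>X \<tau>\<close> lies in \<open>B\<close>, and the restricted law of
  \<open>X \<tau>\<close> bound to the kernel. Equality on sets therefore gives equality for all
  \<open>f\<close> at once.\<close>

lemma nn_integral_transition_distribution:
  assumes "prob_space M" and X [measurable]: "\<And>r. X r \<in> borel_measurable M"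
    and trans: "transition_distribution M X \<eta>" and "0 < t"
    and [measurable]: "f \<in> borel_measurable borel" "B \<in> sets borel"
  shows "(\<integral>\<^sup>+\<omega>. indicator B (X \<tau> \<omega>) * f (X (\<tau> + t) \<omega>) \<partial>M) =
    (\<integral>\<^sup>+\<omega>. indicator B (X \<tau> \<omega>) * (\<integral>\<^sup>+x. f x \<partial>\<eta> t (X \<tau> \<omega>)) \<partial>M)"
proof -
  have kernel [measurable]: "\<eta> t \<in> borel \<rightarrow>\<^sub>M subprob_algebra borel"
    using trans \<open>0 < t\<close> by (auto simp: transition_distribution_def intro: measurable_prob_algebraD)
  define M' where "M' = density M (\<lambda>\<omega>. indicator B (X \<tau> \<omega>))"
  have [measurable_cong]: "sets M' = sets M"
    by (simp add: M'_def)
  have sets_\<eta>: "sets (\<eta> t y) = sets borel" for y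
    using measurable_space[OF kernel] by (simp add: space_subprob_algebra)
  have "distr M' borel (X (\<tau> + t)) = distr M' borel (X \<tau>) \<bind> \<eta> t"
  proof (rule measure_eqI)
    fix A assume "A \<in> sets (distr M' borel (X (\<tau> + t)))"
    hence A [measurable]: "A \<in> sets borel" by simp
    have "emeasure (distr M' borel (X (\<tau> + t))) A = (\<integral>\<^sup>+x. indicator A x \<partial>distr M' borel (X (\<tau> + t)))"
      by simp
    also have "\<dots> = (\<integral>\<^sup>+\<omega>. indicator A (X (\<tau> + t) \<omega>) \<partial>M')"
      by (rule nn_integral_distr) measurable
    also have "\<dots> = (\<integral>\<^sup>+\<omega>. indicator B (X \<tau> \<omega>) * indicator A (X (\<tau> + t) \<omega>) \<partial>M)"
      unfolding M'_def by (subst nn_integral_density) auto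
    also have "\<dots> = (\<integral>\<^sup>+\<omega>. indicator B (X \<tau> \<omega>) * emeasure (\<eta> t (X \<tau> \<omega>)) A \<partial>M)"
      using assms by (intro emeasure_transition_distribution) auto
    also have "\<dots> = (\<integral>\<^sup>+\<omega>. emeasure (\<eta> t (X \<tau> \<omega>)) A \<partial>M')"
      unfolding M'_def by (subst nn_integral_density) auto
    also have "\<dots> = emeasure (distr M' borel (X \<tau>) \<bind> \<eta> t) A"
      by (subst emeasure_bind[where N = borel]) (auto simp: nn_integral_distr)
    finally show "emeasure (distr M' borel (X (\<tau> + t))) A = emeasure (distr M' borel (X \<tau>) \<bind> \<eta> t) A" .
  qed (subst sets_bind[where N = borel], auto simp: sets_\<eta>)
  hence "(\<integral>\<^sup>+x. f x \<partial>distr M' borel (X (\<tau> + t))) = (\<integral>\<^sup>+x. f x \<partial>(distr M' borel (X \<tau>) \<bind> \<eta> t))"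
    by simp
  also have "\<dots> = (\<integral>\<^sup>+\<omega>. (\<integral>\<^sup>+x. f x \<partial>\<eta> t (X \<tau> \<omega>)) \<partial>M')"
    by (subst nn_integral_bind[where B = borel]) (auto simp: nn_integral_distr)
  finally show ?thesis
    by (simp add: nn_integral_distr M'_def nn_integral_density)
qed

text \<open>Finiteness of the iterated integral makes \<open>f\<close> integrable under almost every
  \<open>\<eta> t (X \<tau> \<omega>)\<close>; without that the Bochner integral would default to 0.
  The conditional expectation is then identified on the sets of the present algebra, which are the
  preimages under \<open>X \<tau>\<close>. The integrability conjunct later allows the positive and
  negative parts of a signed function to be subtracted.\<close>

lemma real_cond_exp_transition_distribution_nonneg:
  assumes "prob_space M" and X [measurable]: "\<And>r. X r \<in> borel_measurable M"
    and trans: "transition_distribution M X \<eta>" and "0 < t"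
    and [measurable]: "f \<in> borel_measurable borel" and nonneg: "\<And>x. 0 \<le> f x"
    and int: "integrable M (\<lambda>\<omega>. f (X (\<tau> + t) \<omega>))"
  shows "AE \<omega> in M. integrable (\<eta> t (X \<tau> \<omega>)) f \<and>
    real_cond_exp M (present_algebra M X \<tau>) (\<lambda>\<omega>. f (X (\<tau> + t) \<omega>)) \<omega> = (\<integral>x. f x \<partial>\<eta> t (X \<tau> \<omega>))"
proof -
  interpret prob_space M by fact
  interpret F: finite_measure_subalgebra M "present_algebra M X \<tau>"
    by unfold_locales (intro present_algebra_subalgebra X)
  have kernel [measurable]: "\<eta> t \<in> borel \<rightarrow>\<^sub>M subprob_algebra borel"
    using trans \<open>0 < t\<close> by (auto simp: transition_distribution_def intro: measurable_prob_algebraD)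
  have sets_\<eta>: "sets (\<eta> t y) = sets borel" for y
    using measurable_space[OF kernel] by (simp add: space_subprob_algebra)
  note nn = nn_integral_transition_distribution[OF assms(1-4), of "\<lambda>x. ennreal (f x)"]
  have "(\<integral>\<^sup>+\<omega>. (\<integral>\<^sup>+x. f x \<partial>\<eta> t (X \<tau> \<omega>)) \<partial>M) = (\<integral>\<^sup>+\<omega>. f (X (\<tau> + t) \<omega>) \<partial>M)"
    using nn[of UNIV] by simp
  also have "\<dots> < \<infinity>"
    using int nonneg by (simp add: integrable_iff_bounded)
  finally have "AE \<omega> in M. (\<integral>\<^sup>+x. f x \<partial>\<eta> t (X \<tau> \<omega>)) \<noteq> \<infinity>"
    by (intro nn_integral_noteq_infinite) auto
  hence AE_int: "AE \<omega> in M. integrable (\<eta> t (X \<tau> \<omega>)) f"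
    by eventually_elim (use nonneg in \<open>auto simp: integrable_iff_bounded sets_\<eta> less_top
      cong: measurable_cong_sets\<close>)
  have integral_eq: "(\<integral>\<^sup>+\<omega>. indicator B (X \<tau> \<omega>) * ennreal (\<integral>x. f x \<partial>\<eta> t (X \<tau> \<omega>)) \<partial>M)
      = (\<integral>\<^sup>+\<omega>. indicator B (X \<tau> \<omega>) * ennreal (f (X (\<tau> + t) \<omega>)) \<partial>M)"
    if "B \<in> sets borel" for B
  proof -
    have "AE \<omega> in M. ennreal (\<integral>x. f x \<partial>\<eta> t (X \<tau> \<omega>)) = (\<integral>\<^sup>+x. f x \<partial>\<eta> t (X \<tau> \<omega>))"
      using AE_int by eventually_elim (simp add: nn_integral_eq_integral nonneg)
    hence "(\<integral>\<^sup>+\<omega>. indicator B (X \<tau> \<omega>) * ennreal (\<integral>x. f x \<partial>\<eta> t (X \<tau> \<omega>)) \<partial>M)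
        = (\<integral>\<^sup>+\<omega>. indicator B (X \<tau> \<omega>) * (\<integral>\<^sup>+x. f x \<partial>\<eta> t (X \<tau> \<omega>)) \<partial>M)"
      by (intro nn_integral_cong_AE) auto
    thus ?thesis
      using nn[of B] that by simp
  qed
  have int': "integrable M (\<lambda>\<omega>. \<integral>x. f x \<partial>\<eta> t (X \<tau> \<omega>))"
  proof (rule integrableI_nonneg)
    show "(\<integral>\<^sup>+\<omega>. ennreal (\<integral>x. f x \<partial>\<eta> t (X \<tau> \<omega>)) \<partial>M) < \<infinity>"
      using integral_eq[of UNIV] int nonneg by (simp add: integrable_iff_bounded)
  qed (use nonneg in auto)
  note [measurable] = measurable_present_algebra
  have "AE \<omega> in M. real_cond_exp M (present_algebra M X \<tau>) (\<lambda>\<omega>. f (X (\<tau> + t) \<omega>)) \<omega> = (\<integral>x. f x \<partial>\<eta> t (X \<tau> \<omega>))"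
  proof (rule F.real_cond_exp_charact[OF _ int int'])
    fix A assume "A \<in> sets (present_algebra M X \<tau>)"
    then obtain B where [measurable]: "B \<in> sets borel" and A: "A = X \<tau> -` B \<inter> space M"
      by (auto simp: present_algebra_def sets_vimage_algebra2)
    have set_integral: "(LINT \<omega>:A|M. g \<omega>) = enn2real (\<integral>\<^sup>+\<omega>. indicator B (X \<tau> \<omega>) * ennreal (g \<omega>) \<partial>M)"
      if [measurable]: "g \<in> borel_measurable M" and "\<And>\<omega>. 0 \<le> g \<omega>" for g
    proof -
      have "(LINT \<omega>:A|M. g \<omega>) = (LINT \<omega>|M. indicat_real B (X \<tau> \<omega>) * g \<omega>)"
        unfolding set_lebesgue_integral_def A by (intro Bochner_Integration.integral_cong) (auto simp: indicator_def)
      also have "\<dots> = enn2real (\<integral>\<^sup>+\<omega>. ennreal (indicat_real B (X \<tau> \<omega>) * g \<omega>) \<partial>M)"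
        using that by (intro integral_eq_nn_integral) auto
      also have "(\<integral>\<^sup>+\<omega>. ennreal (indicat_real B (X \<tau> \<omega>) * g \<omega>) \<partial>M) = (\<integral>\<^sup>+\<omega>. indicator B (X \<tau> \<omega>) * ennreal (g \<omega>) \<partial>M)"
        by (intro nn_integral_cong) (auto simp: indicator_def)
      finally show ?thesis .
    qed
    show "(LINT \<omega>:A|M. f (X (\<tau> + t) \<omega>)) = (LINT \<omega>:A|M. \<integral>x. f x \<partial>\<eta> t (X \<tau> \<omega>))"
      using nonneg integral_eq[of B] by (simp add: set_integral)
  qed measurable
  with AE_int show ?thesis
    by eventually_elim simp
qed

lemma real_cond_exp_transition_distribution:
  assumes "prob_space M" and X [measurable]: "\<And>r. X r \<in> borel_measurable M"
    and trans: "transition_distribution M X \<eta>" and "0 < t"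
    and [measurable]: "f \<in> borel_measurable borel"
    and int: "integrable M (\<lambda>\<omega>. f (X (\<tau> + t) \<omega>))"
  shows "AE \<omega> in M. real_cond_exp M (present_algebra M X \<tau>) (\<lambda>\<omega>. f (X (\<tau> + t) \<omega>)) \<omega> =
    (\<integral>x. f x \<partial>\<eta> t (X \<tau> \<omega>))"
proof -
  interpret prob_space M by fact
  interpret F: finite_measure_subalgebra M "present_algebra M X \<tau>"
    by unfold_locales (intro present_algebra_subalgebra X)
  have int_pos: "integrable M (\<lambda>\<omega>. max 0 (f (X (\<tau> + t) \<omega>)))"
    and int_neg: "integrable M (\<lambda>\<omega>. max 0 (- f (X (\<tau> + t) \<omega>)))"
    using int by auto
  have pos: "AE \<omega> in M. integrable (\<eta> t (X \<tau> \<omega>)) (\<lambda>x. max 0 (f x)) \<and>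
      real_cond_exp M (present_algebra M X \<tau>) (\<lambda>\<omega>. max 0 (f (X (\<tau> + t) \<omega>))) \<omega> =
      (\<integral>x. max 0 (f x) \<partial>\<eta> t (X \<tau> \<omega>))"
    and neg: "AE \<omega> in M. integrable (\<eta> t (X \<tau> \<omega>)) (\<lambda>x. max 0 (- f x)) \<and>
      real_cond_exp M (present_algebra M X \<tau>) (\<lambda>\<omega>. max 0 (- f (X (\<tau> + t) \<omega>))) \<omega> =
      (\<integral>x. max 0 (- f x) \<partial>\<eta> t (X \<tau> \<omega>))"
    by (rule real_cond_exp_transition_distribution_nonneg[OF assms(1-4) _ _ int_pos]; simp)
      (rule real_cond_exp_transition_distribution_nonneg[OF assms(1-4) _ _ int_neg]; simp)
  have split: "max 0 z - max 0 (- z) = z" for z :: real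
    by simp
  show ?thesis
    using F.real_cond_exp_diff[OF int_pos int_neg] pos neg
  proof eventually_elim
    case (elim \<omega>)
    hence "(\<integral>x. max 0 (f x) - max 0 (- f x) \<partial>\<eta> t (X \<tau> \<omega>)) =
        (\<integral>x. max 0 (f x) \<partial>\<eta> t (X \<tau> \<omega>)) - (\<integral>x. max 0 (- f x) \<partial>\<eta> t (X \<tau> \<omega>))"
      by (intro Bochner_Integration.integral_diff) auto
    thus ?case
      using elim by (simp add: split)
  qed
qed

section \<open>Coefficients of square integrable expansions\<close>

lemma integrable_mult_of_squares:
  fixes f g :: "'a \<Rightarrow> real"
  assumes [measurable]: "f \<in> borel_measurable M" "g \<in> borel_measurable M"
    and "integrable M (\<lambda>x. (f x)\<^sup>2)" "integrable M (\<lambda>x. (g x)\<^sup>2)"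
  shows "integrable M (\<lambda>x. f x * g x)"
proof (rule Bochner_Integration.integrable_bound)
  show "integrable M (\<lambda>x. (f x)\<^sup>2 + (g x)\<^sup>2)"
    using assms by auto
  show "AE x in M. norm (f x * g x) \<le> norm ((f x)\<^sup>2 + (g x)\<^sup>2)"
  proof (rule AE_I2)
    fix x
    have "2 * (\<bar>f x\<bar> * \<bar>g x\<bar>) \<le> (f x)\<^sup>2 + (g x)\<^sup>2"
      using sum_squares_bound[of "\<bar>f x\<bar>" "\<bar>g x\<bar>"] by (simp add: mult.assoc)
    moreover have "0 \<le> \<bar>f x\<bar> * \<bar>g x\<bar>"
      by simp
    ultimately have "\<bar>f x\<bar> * \<bar>g x\<bar> \<le> (f x)\<^sup>2 + (g x)\<^sup>2"
      by linarith
    thus "norm (f x * g x) \<le> norm ((f x)\<^sup>2 + (g x)\<^sup>2)"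
      by (simp add: abs_mult)
  qed
qed measurable

text \<open>Every partial sum that includes the index \<open>n\<close> leaves the same component
  \<open>a\<close> along \<open>u n\<close>, so \<open>a\<close> squared is bounded by errors that
  tend to 0.\<close>

lemma orthonormal_expansion_coefficient:
  fixes p :: "'a \<Rightarrow> real" and u :: "nat \<Rightarrow> 'a \<Rightarrow> real"
  assumes [measurable]: "p \<in> borel_measurable M" "\<And>n. u n \<in> borel_measurable M"
    and p2: "integrable M (\<lambda>x. (p x)\<^sup>2)" and u2: "\<And>n. integrable M (\<lambda>x. (u n x)\<^sup>2)"
    and ortho: "\<And>i j. (\<integral>x. u i x * u j x \<partial>M) = (if i = j then 1 else 0)"
    and lim: "(\<lambda>N. \<integral>x. (p x - (\<Sum>n<N. c n * u n x))\<^sup>2 \<partial>M) \<longlonglongrightarrow> 0"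
  shows "(\<integral>x. p x * u n x \<partial>M) = c n"
proof -
  note [simp] = integrable_mult_of_squares
  define a where "a = (\<integral>x. p x * u n x \<partial>M) - c n"
  \<comment> \<open>Bessel: expand the nonnegative integral of \<open>(e - a u\<^sub>n)\<^sup>2\<close>, where \<open>e\<close> is the error of the partial sum.\<close>
  have "a\<^sup>2 \<le> (\<integral>x. (p x - (\<Sum>n<N. c n * u n x))\<^sup>2 \<partial>M)" if "n < N" for N
  proof -
    define e where "e x = p x - (\<Sum>n<N. c n * u n x)" for x
    have [measurable]: "e \<in> borel_measurable M"
      unfolding e_def by measurable
    have e2: "integrable M (\<lambda>x. (e x)\<^sup>2)"
    proof -
      \<comment> \<open>One factor \<open>e\<close> is expanded at a time: first against a square
        integrable \<open>v\<close>, then with \<open>v\<close> running through the functions that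
        make up the other \<open>e\<close>.\<close>
      have ve: "integrable M (\<lambda>x. v x * e x)"
        if [measurable]: "v \<in> borel_measurable M" and v2: "integrable M (\<lambda>x. (v x)\<^sup>2)" for v
      proof -
        have "integrable M (\<lambda>x. v x * p x - (\<Sum>n<N. c n * (v x * u n x)))"
          using p2 u2 v2 by simp
        thus ?thesis by (simp add: e_def algebra_simps sum_distrib_left)
      qed
      have "(e x)\<^sup>2 = p x * e x - (\<Sum>n<N. c n * (u n x * e x))" for x
      proof -
        have "(e x)\<^sup>2 = (p x - (\<Sum>n<N. c n * u n x)) * e x"
          by (simp add: e_def power2_eq_square)
        thus ?thesis
          by (simp add: left_diff_distrib sum_distrib_right mult.assoc)
      qed
      thus ?thesis
        using ve p2 u2 by (simp del: integrable_mult_of_squares)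
    qed
    have "(\<integral>x. e x * u n x \<partial>M) = (\<integral>x. p x * u n x - (\<Sum>k<N. c k * (u k x * u n x)) \<partial>M)"
      by (simp add: e_def algebra_simps sum_distrib_left sum_distrib_right)
    also have "\<dots> = (\<integral>x. p x * u n x \<partial>M) - (\<Sum>k<N. c k * (\<integral>x. u k x * u n x \<partial>M))"
      using p2 u2 by simp
    also have "\<dots> = a"
      using \<open>n < N\<close> by (simp add: a_def ortho if_distrib[of "\<lambda>x. _ * x"] cong: if_cong)
    finally have eu: "(\<integral>x. e x * u n x \<partial>M) = a" .
    have uu: "(\<integral>x. (u n x)\<^sup>2 \<partial>M) = 1"
      using ortho[of n n] by (simp add: power2_eq_square)
    have "0 \<le> (\<integral>x. (e x - a * u n x)\<^sup>2 \<partial>M)"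
      by simp
    also have "\<dots> = (\<integral>x. (e x)\<^sup>2 - 2 * a * (e x * u n x) + a\<^sup>2 * (u n x)\<^sup>2 \<partial>M)"
      by (simp add: power2_eq_square algebra_simps)
    also have "\<dots> = (\<integral>x. (e x)\<^sup>2 \<partial>M) - 2 * a * (\<integral>x. e x * u n x \<partial>M) + a\<^sup>2 * (\<integral>x. (u n x)\<^sup>2 \<partial>M)"
      using e2 u2 by simp
    also have "\<dots> = (\<integral>x. (e x)\<^sup>2 \<partial>M) - a\<^sup>2"
      unfolding eu uu by (simp add: power2_eq_square)
    finally show ?thesis by (simp add: e_def)
  qed
  hence "\<forall>\<^sub>F N in sequentially. a\<^sup>2 \<le> (\<integral>x. (p x - (\<Sum>n<N. c n * u n x))\<^sup>2 \<partial>M)"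
    using eventually_gt_at_top[of n] by (rule eventually_mono[rotated])
  hence "a\<^sup>2 \<le> 0"
    using lim by (intro tendsto_lowerbound[OF lim]) auto
  thus ?thesis by (simp add: a_def)
qed

subsection \<open>Mixed moments of the process\<close>

lemma borel_measurable_poly [measurable]: "(\<lambda>x. poly p x) \<in> borel_measurable borel" for p :: "real poly"
  by (intro borel_measurable_continuous_onI continuous_intros)

lemma integrable_poly:
  fixes p :: "real poly"
  assumes "\<And>n. integrable \<mu> (\<lambda>x. x ^ n)"
  shows "integrable \<mu> (\<lambda>x. poly p x)"
  unfolding poly_altdef using assms by auto

lemma power4_diff:
  fixes x y :: "'a::comm_ring_1"
  shows "(x - y) ^ 4 = x ^ 4 - 4 * (x ^ 3 * y) + 6 * (x\<^sup>2 * y\<^sup>2) - 4 * (x * y ^ 3) + y ^ 4"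
  by (simp add: power4_eq_xxxx power3_eq_cube power2_eq_square algebra_simps)

text \<open>Exact degrees make the system triangular: a multiple of \<open>h (Suc n)\<close> removes
  the top coefficient.\<close>

lemma orthonormal_polynomials_span:
  assumes "orthonormal_polynomials \<mu> h" "degree p \<le> n"
  shows "\<exists>c. p = (\<Sum>k\<le>n. smult (c k) (h k))"
  using assms(2)
proof (induction n arbitrary: p)
  case 0
  then obtain a where "p = [:a:]"
    by (auto dest: degree_eq_zeroE)
  moreover have "h 0 = 1"
    using assms(1) by (simp add: orthonormal_polynomials_def)
  ultimately have "p = (\<Sum>k\<le>0. smult a (h k))"
    by (simp add: one_pCons)
  thus ?case by (intro exI[of _ "\<lambda>_. a"])
next
  case (Suc n)
  have deg: "degree (h (Suc n)) = Suc n"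
    using assms(1) by (simp add: orthonormal_polynomials_def)
  define a where "a = coeff p (Suc n) / lead_coeff (h (Suc n))"
  have "lead_coeff (h (Suc n)) \<noteq> 0"
    using deg by (metis degree_0 leading_coeff_0_iff nat.distinct(1))
  hence "coeff (p - smult a (h (Suc n))) (Suc n) = 0"
    by (simp add: a_def deg)
  moreover have "degree (p - smult a (h (Suc n))) \<le> Suc n"
    using Suc.prems deg by (intro degree_diff_le) auto
  ultimately have "degree (p - smult a (h (Suc n))) \<le> n"
    by (metis Suc.IH coeff_0 degree_0 le_Suc_eq leading_coeff_0_iff zero_le)
  then obtain c where "p - smult a (h (Suc n)) = (\<Sum>k\<le>n. smult (c k) (h k))"
    using Suc.IH by blast
  hence "p = (\<Sum>k\<le>n. smult ((c(Suc n := a)) k) (h k)) + smult a (h (Suc n))"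
    by (simp add: algebra_simps)
  hence "p = (\<Sum>k\<le>Suc n. smult ((c(Suc n := a)) k) (h k))"
    by simp
  thus ?case by blast
qed

section \<open>Polynomials in the orthonormal basis\<close>

locale orthonormal_moments = prob_space \<mu> for \<mu> :: "real measure" +
  fixes h :: "nat \<Rightarrow> real poly"
  assumes sets_eq [measurable_cong]: "sets \<mu> = sets borel"
    and moments: "\<And>n. integrable \<mu> (\<lambda>x. x ^ n)"
    and ortho: "orthonormal_polynomials \<mu> h"
begin

definition inner_poly :: "real poly \<Rightarrow> real poly \<Rightarrow> real" where
  "inner_poly p q = (\<integral>x. poly p x * poly q x \<partial>\<mu>)"

lemma integrable_poly_mult: "integrable \<mu> (\<lambda>x. poly p x * poly q x)"
  using integrable_poly[OF moments, of "p * q"] by simp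

lemma inner_poly_commute: "inner_poly p q = inner_poly q p"
  by (simp add: inner_poly_def mult.commute)

lemma inner_poly_orthonormal: "inner_poly (h i) (h j) = (if i = j then 1 else 0)"
  using ortho by (simp add: inner_poly_def orthonormal_polynomials_def)

lemma inner_poly_sum_right: "inner_poly p (\<Sum>k\<in>K. smult (c k) (q k)) = (\<Sum>k\<in>K. c k * inner_poly p (q k))"
proof -
  have "inner_poly p (\<Sum>k\<in>K. smult (c k) (q k)) = (\<integral>x. (\<Sum>k\<in>K. c k * (poly p x * poly (q k) x)) \<partial>\<mu>)"
    by (simp add: inner_poly_def poly_sum sum_distrib_left algebra_simps)
  also have "\<dots> = (\<Sum>k\<in>K. c k * inner_poly p (q k))"
    by (simp add: integrable_poly_mult inner_poly_def)
  finally show ?thesis .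
qed

lemma poly_expansion:
  assumes "degree p \<le> n"
  shows "p = (\<Sum>k\<le>n. smult (inner_poly p (h k)) (h k))"
proof -
  obtain c where c: "p = (\<Sum>k\<le>n. smult (c k) (h k))"
    using orthonormal_polynomials_span[OF ortho assms] by blast
  have "inner_poly p (h k) = c k" if "k \<le> n" for k
    unfolding inner_poly_commute[of p] using that
    by (subst c) (simp add: inner_poly_sum_right inner_poly_orthonormal if_distrib[of "\<lambda>x. _ * x"] cong: if_cong)
  thus ?thesis
    by (subst c) (rule sum.cong, auto)
qed

text \<open>Parseval as a finite sum. The degree of one factor truncates it, so pairing with a
  linear polynomial involves only the indices 0 and 1.\<close>

lemma inner_poly_eq_sum:
  assumes "degree q \<le> n"
  shows "inner_poly p q = (\<Sum>k\<le>n. inner_poly p (h k) * inner_poly q (h k))"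
  by (subst poly_expansion[OF assms]) (simp add: inner_poly_sum_right mult.commute)

lemma inner_poly_eq_0:
  assumes "degree p < k"
  shows "inner_poly p (h k) = 0"
  unfolding inner_poly_commute[of p] using assms
  by (subst poly_expansion[OF order_refl]) (simp add: inner_poly_sum_right inner_poly_orthonormal)

text \<open>Square integrability makes the extended real derivative finite almost everywhere, so
  \<open>enn2real\<close> loses nothing and \<open>\<rho>\<close> has a real density in L2, whose
  coefficients are known.\<close>

lemma integral_L2_density:
  assumes "sets \<rho> = sets borel" "absolutely_continuous \<mu> \<rho>"
    and finite: "(\<integral>\<^sup>+x. (RN_deriv \<mu> \<rho> x)\<^sup>2 \<partial>\<mu>) < \<infinity>"
    and lim: "(\<lambda>N. \<integral>x. (enn2real (RN_deriv \<mu> \<rho> x) - (\<Sum>n<N. c n * poly (h n) x))\<^sup>2 \<partial>\<mu>) \<longlonglongrightarrow> 0"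
  shows "(\<integral>x. poly (h n) x \<partial>\<rho>) = c n"
proof -
  define d where "d x = enn2real (RN_deriv \<mu> \<rho> x)" for x
  have [measurable]: "d \<in> borel_measurable \<mu>"
    unfolding d_def by measurable
  have "AE x in \<mu>. (RN_deriv \<mu> \<rho> x)\<^sup>2 \<noteq> \<infinity>"
    using finite by (intro nn_integral_noteq_infinite) auto
  hence AE_d: "AE x in \<mu>. RN_deriv \<mu> \<rho> x = ennreal (d x)"
    by eventually_elim (auto simp: d_def less_top power_eq_top_ennreal)
  have "\<rho> = density \<mu> (RN_deriv \<mu> \<rho>)"
    using assms sets_eq by (intro density_RN_deriv[symmetric]) auto
  also have "\<dots> = density \<mu> (\<lambda>x. ennreal (d x))"
    using AE_d by (intro density_cong) auto
  finally have \<rho>: "\<rho> = density \<mu> (\<lambda>x. ennreal (d x))" .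
  have d_nonneg: "0 \<le> d x" for x
    by (simp add: d_def)
  have "(\<integral>\<^sup>+x. ennreal ((d x)\<^sup>2) \<partial>\<mu>) = (\<integral>\<^sup>+x. (RN_deriv \<mu> \<rho> x)\<^sup>2 \<partial>\<mu>)"
  proof (rule nn_integral_cong_AE)
    show "AE x in \<mu>. ennreal ((d x)\<^sup>2) = (RN_deriv \<mu> \<rho> x)\<^sup>2"
      using AE_d by eventually_elim (simp add: ennreal_power d_nonneg)
  qed
  hence d2: "integrable \<mu> (\<lambda>x. (d x)\<^sup>2)"
    using finite by (intro integrableI_nonneg) auto
  have "(\<integral>x. poly (h n) x \<partial>\<rho>) = (\<integral>x. d x * poly (h n) x \<partial>\<mu>)"
    unfolding \<rho> by (subst integral_density) (auto simp: d_nonneg)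
  also have "\<dots> = c n"
  proof (rule orthonormal_expansion_coefficient[OF _ _ d2])
    show "integrable \<mu> (\<lambda>x. (poly (h n) x)\<^sup>2)" for n
      using integrable_poly_mult[of "h n" "h n"] by (simp add: power2_eq_square)
    show "(\<integral>x. poly (h i) x * poly (h j) x \<partial>\<mu>) = (if i = j then 1 else 0)" for i j
      using inner_poly_orthonormal by (simp add: inner_poly_def)
    show "(\<lambda>N. \<integral>x. (d x - (\<Sum>n<N. c n * poly (h n) x))\<^sup>2 \<partial>\<mu>) \<longlonglongrightarrow> 0"
      using lim by (simp add: d_def)
  qed measurable
  finally show ?thesis .
qed

end

section \<open>Moments of the process at two times\<close>

locale SMPR_process = orthonormal_moments \<mu> h for \<mu> :: "real measure" and h +
  fixes M :: "'a measure" and X :: "real \<Rightarrow> 'a \<Rightarrow> real" and \<alpha> :: "nat \<Rightarrow> real"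
  assumes SMPR: "SMPR M X \<alpha> \<mu> h"
begin

lemma prob_space_M: "prob_space M"
  and borel_measurable_X [measurable]: "X t \<in> borel_measurable M"
  and distr_X: "distr M borel (X t) = \<mu>"
  and \<alpha>_0: "\<alpha> 0 = 0"
  and \<alpha>_pos: "n \<ge> 1 \<Longrightarrow> 0 < \<alpha> n"
  using SMPR by (auto simp: SMPR_def)

lemma integrable_poly_X: "integrable M (\<lambda>\<omega>. poly p (X t \<omega>))"
  using integrable_poly[OF moments, of p] integrable_distr_eq[of "X t" M borel "poly p"]
  by (simp add: distr_X)

lemma integral_poly_X: "(\<integral>\<omega>. poly p (X t \<omega>) \<partial>M) = (\<integral>x. poly p x \<partial>\<mu>)"
  using integral_distr[of "X t" M borel "poly p"] by (simp add: distr_X)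

lemma integrable_poly_mult_X: "integrable M (\<lambda>\<omega>. poly p (X s \<omega>) * poly q (X t \<omega>))"
  using integrable_poly_X[of "p\<^sup>2" s] integrable_poly_X[of "q\<^sup>2" t]
  by (intro integrable_mult_of_squares) (auto simp: poly_power)

lemma integral_mult_orthonormal:
  assumes "0 < t"
  shows "(\<integral>\<omega>. poly p (X \<tau> \<omega>) * poly (h n) (X (\<tau> + t) \<omega>) \<partial>M) = exp (- \<alpha> n * t) * inner_poly p (h n)"
proof -
  interpret M: prob_space M by (rule prob_space_M)
  interpret F: finite_measure_subalgebra M "present_algebra M X \<tau>"
    by unfold_locales (intro present_algebra_subalgebra borel_measurable_X)
  note [measurable] = measurable_present_algebra[of X \<tau> M]
  obtain \<eta> where trans: "transition_distribution M X \<eta>" and expan: "has_polynomial_expansion \<mu> h \<alpha> \<eta>"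
    using SMPR by (auto simp: SMPR_def)
  have kernel: "\<eta> t \<in> borel \<rightarrow>\<^sub>M subprob_algebra borel"
    using trans \<open>0 < t\<close> by (auto simp: transition_distribution_def intro: measurable_prob_algebraD)
  have sets_\<eta>: "sets (\<eta> t y) = sets borel" for y
    using measurable_space[OF kernel] by (simp add: space_subprob_algebra)
  have "AE y in \<mu>. absolutely_continuous \<mu> (\<eta> t y) \<and> (\<integral>\<^sup>+x. (RN_deriv \<mu> (\<eta> t y) x)\<^sup>2 \<partial>\<mu>) < \<infinity> \<and>
      (\<lambda>N. \<integral>x. (enn2real (RN_deriv \<mu> (\<eta> t y) x)
         - (\<Sum>n<N. exp (- \<alpha> n * t) * poly (h n) x * poly (h n) y))\<^sup>2 \<partial>\<mu>) \<longlonglongrightarrow> 0"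
    using expan \<open>0 < t\<close> unfolding has_polynomial_expansion_def by blast
  hence "AE y in \<mu>. (\<integral>x. poly (h n) x \<partial>\<eta> t y) = exp (- \<alpha> n * t) * poly (h n) y"
  proof eventually_elim
    case (elim y)
    thus ?case
      by (intro integral_L2_density[OF sets_\<eta>, of y "\<lambda>n. exp (- \<alpha> n * t) * poly (h n) y"])
        (auto simp: mult.assoc mult.commute[of "poly _ y"])
  qed
  \<comment> \<open>The law of \<open>X \<tau>\<close> is \<mu>, so an exceptional \<mu>-null set of
    starting points is almost surely avoided.\<close>
  hence "AE \<omega> in M. (\<integral>x. poly (h n) x \<partial>\<eta> t (X \<tau> \<omega>)) = exp (- \<alpha> n * t) * poly (h n) (X \<tau> \<omega>)"
    by (intro AE_distrD[where M' = borel and f = "X \<tau>"]) (simp_all only: distr_X borel_measurable_X)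
  moreover have "AE \<omega> in M. real_cond_exp M (present_algebra M X \<tau>) (\<lambda>\<omega>. poly (h n) (X (\<tau> + t) \<omega>)) \<omega> =
      (\<integral>x. poly (h n) x \<partial>\<eta> t (X \<tau> \<omega>))"
    by (rule real_cond_exp_transition_distribution[OF prob_space_M borel_measurable_X trans \<open>0 < t\<close>])
      (auto intro: integrable_poly_X)
  ultimately have AE_eq: "AE \<omega> in M. real_cond_exp M (present_algebra M X \<tau>) (\<lambda>\<omega>. poly (h n) (X (\<tau> + t) \<omega>)) \<omega> =
      exp (- \<alpha> n * t) * poly (h n) (X \<tau> \<omega>)"
    by eventually_elim simp
  have "(\<integral>\<omega>. poly p (X \<tau> \<omega>) * poly (h n) (X (\<tau> + t) \<omega>) \<partial>M) = (\<integral>\<omega>. poly p (X \<tau> \<omega>) *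
      real_cond_exp M (present_algebra M X \<tau>) (\<lambda>\<omega>. poly (h n) (X (\<tau> + t) \<omega>)) \<omega> \<partial>M)"
    by (rule F.real_cond_exp_intg(2)[symmetric, OF integrable_poly_mult_X]) measurable
  also have "\<dots> = (\<integral>\<omega>. poly p (X \<tau> \<omega>) * (exp (- \<alpha> n * t) * poly (h n) (X \<tau> \<omega>)) \<partial>M)"
    using AE_eq by (intro integral_cong_AE) auto
  also have "\<dots> = (\<integral>\<omega>. exp (- \<alpha> n * t) * poly (p * h n) (X \<tau> \<omega>) \<partial>M)"
    by (intro Bochner_Integration.integral_cong) auto
  also have "\<dots> = exp (- \<alpha> n * t) * (\<integral>\<omega>. poly (p * h n) (X \<tau> \<omega>) \<partial>M)"
    by (rule integral_mult_right_zero)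
  also have "\<dots> = exp (- \<alpha> n * t) * inner_poly p (h n)"
    by (simp only: integral_poly_X) (simp add: inner_poly_def)
  finally show ?thesis .
qed

lemma integral_poly_mult_X:
  assumes "0 < t" "degree q \<le> n"
  shows "(\<integral>\<omega>. poly p (X \<tau> \<omega>) * poly q (X (\<tau> + t) \<omega>) \<partial>M) =
    (\<Sum>k\<le>n. exp (- \<alpha> k * t) * inner_poly p (h k) * inner_poly q (h k))"
proof -
  have "(\<integral>\<omega>. poly p (X \<tau> \<omega>) * poly q (X (\<tau> + t) \<omega>) \<partial>M) =
      (\<integral>\<omega>. (\<Sum>k\<le>n. inner_poly q (h k) * (poly p (X \<tau> \<omega>) * poly (h k) (X (\<tau> + t) \<omega>))) \<partial>M)"
    by (subst poly_expansion[OF assms(2)]) (simp add: poly_sum sum_distrib_left algebra_simps)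
  also have "\<dots> = (\<Sum>k\<le>n. inner_poly q (h k) *
      (\<integral>\<omega>. poly p (X \<tau> \<omega>) * poly (h k) (X (\<tau> + t) \<omega>) \<partial>M))"
    by (simp add: integrable_poly_mult_X)
  also have "\<dots> = (\<Sum>k\<le>n. exp (- \<alpha> k * t) * inner_poly p (h k) * inner_poly q (h k))"
    using \<open>0 < t\<close> by (simp add: integral_mult_orthonormal algebra_simps)
  finally show ?thesis .
qed

text \<open>Subtracting the mean leaves increments unchanged and removes the component along
  \<open>h 0\<close>.\<close>

definition centred :: "real poly" where
  "centred = [:- (\<integral>x. x \<partial>\<mu>), 1:]"

lemma degree_centred_power: "degree (centred ^ n) = n"
  unfolding centred_def by (rule degree_linear_power)

text \<open>The free splitting i + j matters: reading the fourth moment both as 3 + 1 and as 2 + 2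
  yields two different Parseval identities.\<close>

lemma central_moment_eq_inner_poly: "central_moment \<mu> (i + j) = inner_poly (centred ^ i) (centred ^ j)"
  by (simp add: central_moment_def inner_poly_def centred_def poly_power power_add)

lemma h_0: "h 0 = 1"
  using ortho by (simp add: orthonormal_polynomials_def)

lemma inner_poly_centred:
  assumes "k \<noteq> 1"
  shows "inner_poly centred (h k) = 0"
proof (cases "k = 0")
  case True
  have "integrable \<mu> (\<lambda>x. x)"
    using moments[of 1] by simp
  thus ?thesis
    using True by (simp add: inner_poly_def h_0 centred_def prob_space)
next
  case False
  thus ?thesis
    using assms degree_centred_power[of 1] by (intro inner_poly_eq_0) auto
qed

lemma central_moment_2_eq: "central_moment \<mu> 2 = (inner_poly centred (h 1))\<^sup>2"
proof -
  have "central_moment \<mu> 2 = inner_poly centred centred"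
    using central_moment_eq_inner_poly[of 1 1] by (simp add: numeral_2_eq_2)
  also have "\<dots> = (\<Sum>k\<le>1. inner_poly centred (h k) * inner_poly centred (h k))"
    using degree_centred_power[of 1] by (intro inner_poly_eq_sum) simp
  finally show ?thesis
    by (simp add: inner_poly_centred power2_eq_square)
qed

text \<open>Zero variance would annihilate all coefficients of the nonzero polynomial
  \<open>centred\<close>.\<close>

lemma central_moment_2_pos: "0 < central_moment \<mu> 2"
proof -
  have "inner_poly centred (h 1) \<noteq> 0"
  proof
    assume "inner_poly centred (h 1) = 0"
    hence "inner_poly centred (h k) = 0" for k
      by (cases "k = 1") (auto simp: inner_poly_centred)
    hence "centred = 0"
      using poly_expansion[of centred 1] degree_centred_power[of 1] by simp
    thus False
      by (simp add: centred_def)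
  qed
  thus ?thesis
    by (simp add: central_moment_2_eq)
qed

text \<open>With \<open>a\<close>, \<open>b\<close>, \<open>c\<close> the coefficients of the
  centred coordinate, its square and its cube, m2 = a1^2, m3 = b1 a1 and m4 = c1 a1 = m2^2 + b1^2 +
  b2^2. The mixed terms involve only c1 a1, b1^2 and b2^2 besides m2, so they are functions of the
  moments and do not depend on the signs of the \<open>h k\<close>.\<close>

lemma fourth_moment_increment:
  assumes "0 < t"
  defines "m \<equiv> central_moment \<mu>"
  shows "(\<integral>\<omega>. (X \<tau> \<omega> - X (\<tau> + t) \<omega>) ^ 4 \<partial>M) =
    2 * m 4 - 8 * m 4 * exp (- \<alpha> 1 * t) +
    6 * ((m 2)\<^sup>2 + (m 3)\<^sup>2 / m 2 * exp (- \<alpha> 1 * t) + (m 4 - (m 2)\<^sup>2 - (m 3)\<^sup>2 / m 2) * exp (- \<alpha> 2 * t))"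
proof -
  define a where "a k = inner_poly centred (h k)" for k
  define b where "b k = inner_poly (centred\<^sup>2) (h k)" for k
  define c where "c k = inner_poly (centred ^ 3) (h k)" for k
  have a_0: "a k = 0" if "k \<noteq> 1" for k
    using that inner_poly_centred by (simp add: a_def)
  have sum_1: "(\<Sum>k\<le>1. f k) = f 0 + f 1" and sum_2: "(\<Sum>k\<le>2. f k) = f 0 + f 1 + f 2"
    and sum_3: "(\<Sum>k\<le>3. f k) = f 0 + f 1 + f 2 + f 3" for f :: "nat \<Rightarrow> real"
    by (simp_all add: numeral_2_eq_2 numeral_3_eq_3)
  have deg: "degree centred \<le> 1" "degree (centred\<^sup>2) \<le> 2" "degree (centred ^ 3) \<le> 3"
    using degree_centred_power[of 1] degree_centred_power[of 2] degree_centred_power[of 3] by simp_all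
  have m2: "m 2 = (a 1)\<^sup>2" "0 < m 2"
    using central_moment_2_eq central_moment_2_pos by (simp_all add: m_def a_def)
  have b_0: "b 0 = m 2"
    using central_moment_eq_inner_poly[of 2 0] by (simp add: m_def b_def h_0)
  have m3: "m 3 = b 1 * a 1"
    using central_moment_eq_inner_poly[of 2 1] inner_poly_eq_sum[OF deg(1), of "centred\<^sup>2"] a_0
    unfolding sum_1 by (simp add: m_def flip: a_def b_def)
  have m4: "m 4 = c 1 * a 1"
    using central_moment_eq_inner_poly[of 3 1] inner_poly_eq_sum[OF deg(1), of "centred ^ 3"] a_0
    unfolding sum_1 by (simp add: m_def flip: a_def c_def)
  have m4': "m 4 = (m 2)\<^sup>2 + (b 1)\<^sup>2 + (b 2)\<^sup>2"
    using central_moment_eq_inner_poly[of 2 2] inner_poly_eq_sum[OF deg(2), of "centred\<^sup>2"]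
    unfolding sum_2 by (simp add: m_def[symmetric] b_0 power2_eq_square[of "b _"] flip: b_def)
      (simp add: b_0 power2_eq_square)
  have "a 1 \<noteq> 0"
    using m2 by auto
  hence b_1: "(b 1)\<^sup>2 = (m 3)\<^sup>2 / m 2"
    by (simp add: m2 m3 power_mult_distrib)
  have b_2: "(b 2)\<^sup>2 = m 4 - (m 2)\<^sup>2 - (m 3)\<^sup>2 / m 2"
    using m4' b_1 by simp
  define U where "U \<omega> = poly centred (X \<tau> \<omega>)" for \<omega>
  define V where "V \<omega> = poly centred (X (\<tau> + t) \<omega>)" for \<omega>
  have int: "integrable M (\<lambda>\<omega>. U \<omega> ^ i * V \<omega> ^ j)" for i j
    using integrable_poly_mult_X[of "centred ^ i" \<tau> "centred ^ j" "\<tau> + t"] by (simp add: U_def V_def poly_power)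
  have EU4: "(\<integral>\<omega>. U \<omega> ^ 4 \<partial>M) = m 4" and EV4: "(\<integral>\<omega>. V \<omega> ^ 4 \<partial>M) = m 4"
    using integral_poly_X[of "centred ^ 4"] central_moment_eq_inner_poly[of 4 0]
    by (simp_all add: U_def V_def m_def inner_poly_def poly_power)
  have EU3V: "(\<integral>\<omega>. U \<omega> ^ 3 * V \<omega> \<partial>M) = exp (- \<alpha> 1 * t) * m 4"
    using integral_poly_mult_X[OF \<open>0 < t\<close> deg(1), of "centred ^ 3" \<tau>]
    unfolding sum_1 by (simp add: U_def V_def poly_power m4 a_0 flip: a_def c_def)
  \<comment> \<open>With the cube at the later time the sum runs up to 3, but the linear factor
    removes every index except 1.\<close>
  have EUV3: "(\<integral>\<omega>. U \<omega> * V \<omega> ^ 3 \<partial>M) = exp (- \<alpha> 1 * t) * m 4"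
    using integral_poly_mult_X[OF \<open>0 < t\<close> deg(3), of centred \<tau>]
    unfolding sum_3 by (simp add: U_def V_def poly_power m4 a_0 flip: a_def c_def)
  have EU2V2: "(\<integral>\<omega>. (U \<omega>)\<^sup>2 * (V \<omega>)\<^sup>2 \<partial>M) = (m 2)\<^sup>2 + (b 1)\<^sup>2 * exp (- \<alpha> 1 * t) + (b 2)\<^sup>2 * exp (- \<alpha> 2 * t)"
    using integral_poly_mult_X[OF \<open>0 < t\<close> deg(2), of "centred\<^sup>2" \<tau>]
    unfolding sum_2 by (simp add: U_def V_def poly_power b_0 \<alpha>_0 power2_eq_square[of "b _"] power2_eq_square[of "m _"] flip: b_def)
  have "(X \<tau> \<omega> - X (\<tau> + t) \<omega>) ^ 4 =
      U \<omega> ^ 4 - 4 * (U \<omega> ^ 3 * V \<omega>) + 6 * ((U \<omega>)\<^sup>2 * (V \<omega>)\<^sup>2) - 4 * (U \<omega> * V \<omega> ^ 3) + V \<omega> ^ 4" for \<omega>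
    unfolding power4_diff[symmetric] by (simp add: U_def V_def centred_def)
  hence "(\<integral>\<omega>. (X \<tau> \<omega> - X (\<tau> + t) \<omega>) ^ 4 \<partial>M) = (\<integral>\<omega>. U \<omega> ^ 4 \<partial>M) - 4 * (\<integral>\<omega>. U \<omega> ^ 3 * V \<omega> \<partial>M)
      + 6 * (\<integral>\<omega>. (U \<omega>)\<^sup>2 * (V \<omega>)\<^sup>2 \<partial>M) - 4 * (\<integral>\<omega>. U \<omega> * V \<omega> ^ 3 \<partial>M) + (\<integral>\<omega>. V \<omega> ^ 4 \<partial>M)"
    using int[of 4 0] int[of 3 1] int[of 2 2] int[of 1 3] int[of 0 4] by simp
  thus ?thesis
    unfolding EU4 EV4 EU3V EUV3 EU2V2 b_1 b_2 by (simp add: algebra_simps)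
qed

section \<open>Short-time bound and continuity of paths\<close>

lemma integrable_fourth_power_increment: "integrable M (\<lambda>\<omega>. (X s \<omega> - X t \<omega>) ^ 4)"
proof -
  have int: "integrable M (\<lambda>\<omega>. X s \<omega> ^ i * X t \<omega> ^ j)" for i j
    using integrable_poly_mult_X[of "[:0, 1:] ^ i" s "[:0, 1:] ^ j" t] by (simp add: poly_power)
  show ?thesis
    unfolding power4_diff using int[of 4 0] int[of 3 1] int[of 2 2] int[of 1 3] int[of 0 4] by simp
qed

text \<open>One constant serves all \<tau> and all t > 0; this uniformity is what the continuity
  criterion takes as input.\<close>

lemma fourth_moment_increment_bound:
  defines "m \<equiv> central_moment \<mu>"
  defines "L \<equiv> (\<alpha> 1 * (8 * m 4 * m 2 - 6 * (m 3)\<^sup>2) - 6 * \<alpha> 2 * (m 2 * m 4 - (m 3)\<^sup>2 - (m 2) ^ 3)) / m 2"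
  shows "\<exists>C. \<forall>\<tau>. \<forall>t>0. \<bar>(\<integral>\<omega>. (X \<tau> \<omega> - X (\<tau> + t) \<omega>) ^ 4 \<partial>M) - t * L\<bar> \<le> C * t\<^sup>2"
proof -
  define R where "R = (m 3)\<^sup>2 / m 2"
  \<comment> \<open>\<open>A\<close> and \<open>B\<close> are the coefficients of the two
    exponentials. The constant term is -(A + B), so each exponential can be compared separately with
    its linear approximation.\<close>
  define A where "A = 6 * R - 8 * m 4"
  define B where "B = 6 * (m 4 - (m 2)\<^sup>2 - R)"
  have "m 2 > 0"
    using central_moment_2_pos by (simp add: m_def)
  hence L: "L = - (A * \<alpha> 1 + B * \<alpha> 2)"
    by (simp add: L_def A_def B_def R_def field_simps power2_eq_square power3_eq_cube)
  have remainder: "\<bar>exp (- z) - 1 + z\<bar> \<le> z\<^sup>2" if "0 \<le> z" for z :: real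
  proof -
    \<comment> \<open>The product is 1 + z^3; with 1 + z at most exp z this bounds exp(-z) from
      above.\<close>
    have "1 \<le> (1 - z + z\<^sup>2) * (1 + z)"
      using that by (simp add: algebra_simps power2_eq_square)
    also have "\<dots> \<le> (1 - z + z\<^sup>2) * exp z"
    proof (rule mult_left_mono)
      have "1 - z + z\<^sup>2 = (1 - z / 2)\<^sup>2 + 3 / 4 * z\<^sup>2"
        by (simp add: power2_eq_square algebra_simps)
      thus "0 \<le> 1 - z + z\<^sup>2" by simp
    qed (rule exp_ge_add_one_self)
    finally have "exp (- z) \<le> 1 - z + z\<^sup>2"
      by (simp add: exp_minus field_simps)
    moreover have "1 - z \<le> exp (- z)"
      using exp_ge_add_one_self[of "- z"] by simp
    ultimately show ?thesis by simp
  qed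
  define C where "C = \<bar>A\<bar> * (\<alpha> 1)\<^sup>2 + \<bar>B\<bar> * (\<alpha> 2)\<^sup>2"
  have "\<bar>(\<integral>\<omega>. (X \<tau> \<omega> - X (\<tau> + t) \<omega>) ^ 4 \<partial>M) - t * L\<bar> \<le> C * t\<^sup>2" if "0 < t" for \<tau> t
  proof -
    have "(\<integral>\<omega>. (X \<tau> \<omega> - X (\<tau> + t) \<omega>) ^ 4 \<partial>M) - t * L =
        A * (exp (- (\<alpha> 1 * t)) - 1 + \<alpha> 1 * t) + B * (exp (- (\<alpha> 2 * t)) - 1 + \<alpha> 2 * t)"
      unfolding fourth_moment_increment[OF that, folded m_def, folded R_def] L
      by (simp add: A_def B_def algebra_simps)
    also have "\<bar>\<dots>\<bar> \<le> \<bar>A\<bar> * \<bar>exp (- (\<alpha> 1 * t)) - 1 + \<alpha> 1 * t\<bar> + \<bar>B\<bar> * \<bar>exp (- (\<alpha> 2 * t)) - 1 + \<alpha> 2 * t\<bar>"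
      by (metis abs_mult abs_triangle_ineq)
    also have "\<dots> \<le> \<bar>A\<bar> * (\<alpha> 1 * t)\<^sup>2 + \<bar>B\<bar> * (\<alpha> 2 * t)\<^sup>2"
      using that \<alpha>_pos[of 1] \<alpha>_pos[of 2] by (intro add_mono mult_left_mono remainder) auto
    also have "\<dots> = C * t\<^sup>2"
      by (simp add: C_def power_mult_distrib algebra_simps)
    finally show ?thesis .
  qed
  thus ?thesis by blast
qed

lemma continuous_modification_if_increments_quadratic:
  assumes "\<And>\<tau> t. 0 < t \<Longrightarrow> (\<integral>\<omega>. (X \<tau> \<omega> - X (\<tau> + t) \<omega>) ^ 4 \<partial>M) \<le> C * t\<^sup>2"
  shows "allows_continuous_modification M X"
\<comment> \<open>The exponent 2 is 1 + \<beta>. The bound holds at all distances, so the value of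
  \<delta> is arbitrary.\<close>
proof (rule Kolmogorov_continuity[where p = 4 and \<beta> = 1 and C = C and \<delta> = 1])
  have "0 \<le> (\<integral>\<omega>. (X 0 \<omega> - X (0 + 1) \<omega>) ^ 4 \<partial>M)"
    by simp
  also have "\<dots> \<le> C"
    using assms[of 1 0] by simp
  finally show "0 \<le> C" .
  show "(\<integral>\<^sup>+\<omega>. ennreal (\<bar>X s \<omega> - X t \<omega>\<bar> powr 4) \<partial>M) \<le> ennreal (C * \<bar>s - t\<bar> powr (1 + 1))" for s t
  proof -
    have le: "(\<integral>\<omega>. (X s \<omega> - X t \<omega>) ^ 4 \<partial>M) \<le> C * \<bar>s - t\<bar>\<^sup>2"
    proof (cases s t rule: linorder_cases)
      case less
      thus ?thesis using assms[of "t - s" s] by (simp add: power2_commute)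
    next
      case greater
      thus ?thesis using assms[of "s - t" t] by (simp add: power2_commute power4_eq_xxxx algebra_simps)
    qed simp
    have "(\<integral>\<^sup>+\<omega>. ennreal (\<bar>X s \<omega> - X t \<omega>\<bar> powr 4) \<partial>M) = (\<integral>\<^sup>+\<omega>. ennreal ((X s \<omega> - X t \<omega>) ^ 4) \<partial>M)"
      by simp
    also have "\<dots> = ennreal (\<integral>\<omega>. (X s \<omega> - X t \<omega>) ^ 4 \<partial>M)"
      by (intro nn_integral_eq_integral integrable_fourth_power_increment) simp
    also have "\<dots> \<le> ennreal (C * \<bar>s - t\<bar> powr (1 + 1))"
      using le by (intro ennreal_leI) simp
    finally show ?thesis .
  qed
qed auto

end

theorem corollary1:
  fixes M :: "'a measure" and X :: "real \<Rightarrow> 'a \<Rightarrow> real" and \<mu> :: "real measure"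
    and \<alpha> :: "nat \<Rightarrow> real" and h :: "nat \<Rightarrow> real poly"
  assumes "admissible_marginal \<mu>"
    and "orthonormal_polynomials \<mu> h"
    and "SMPR M X \<alpha> \<mu> h"
  shows
    "let m = central_moment \<mu>; \<kappa> = excess_kurtosis \<mu>; s = skewness \<mu>;
         q = (4 * m 4 * m 2 - 3 * (m 3)\<^sup>2) / (3 * (m 4 * m 2 - (m 3)\<^sup>2 - (m 2) ^ 3));
         q' = (12 + 4 * \<kappa> - 3 * s\<^sup>2) / (6 + 3 * \<kappa> - 3 * s\<^sup>2)
     in
       (\<forall>\<tau>. (\<forall>t. integrable M (\<lambda>\<omega>. (X \<tau> \<omega> - X (\<tau> + t) \<omega>) ^ 4)) \<and>
          (\<lambda>t. (\<integral>\<omega>. (X \<tau> \<omega> - X (\<tau> + t) \<omega>) ^ 4 \<partial>M)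
               - t * ((\<alpha> 1 * (8 * m 4 * m 2 - 6 * (m 3)\<^sup>2)
                       - 6 * \<alpha> 2 * (m 2 * m 4 - (m 3)\<^sup>2 - (m 2) ^ 3)) / m 2))
            \<in> O[at_right 0](\<lambda>t. t\<^sup>2)) \<and>
       (q > 0 \<and> \<alpha> 2 = \<alpha> 1 * q \<longrightarrow> allows_continuous_modification M X) \<and>
       q = q' \<and> (\<alpha> 2 = \<alpha> 1 * q \<longleftrightarrow> \<alpha> 2 = \<alpha> 1 * q')"
proof -
  interpret \<mu>: real_distribution \<mu>
    using assms by (simp add: admissible_marginal_def)
  interpret SMPR_process \<mu> h M X \<alpha>
    using assms by unfold_locales (auto simp: admissible_marginal_def)
  define m where "m = central_moment \<mu>"
  define D where "D = m 4 * m 2 - (m 3)\<^sup>2 - (m 2) ^ 3"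
  define N where "N = 4 * m 4 * m 2 - 3 * (m 3)\<^sup>2"
  define q where "q = N / (3 * D)"
  define q' where "q' = (12 + 4 * excess_kurtosis \<mu> - 3 * (skewness \<mu>)\<^sup>2) / (6 + 3 * excess_kurtosis \<mu> - 3 * (skewness \<mu>)\<^sup>2)"
  define L where "L = (\<alpha> 1 * (8 * m 4 * m 2 - 6 * (m 3)\<^sup>2) - 6 * \<alpha> 2 * (m 2 * m 4 - (m 3)\<^sup>2 - (m 2) ^ 3)) / m 2"
  have "m 2 > 0"
    using central_moment_2_pos by (simp add: m_def)
  obtain C where C: "\<And>\<tau> t. 0 < t \<Longrightarrow> \<bar>(\<integral>\<omega>. (X \<tau> \<omega> - X (\<tau> + t) \<omega>) ^ 4 \<partial>M) - t * L\<bar> \<le> C * t\<^sup>2"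
    using fourth_moment_increment_bound unfolding m_def L_def by blast
  have "(\<lambda>t. (\<integral>\<omega>. (X \<tau> \<omega> - X (\<tau> + t) \<omega>) ^ 4 \<partial>M) - t * L) \<in> O[at_right 0](\<lambda>t. t\<^sup>2)" for \<tau>
    using C by (intro bigoI[where c = C] eventually_mono[OF eventually_at_right_less[of 0]]) auto
  moreover have "allows_continuous_modification M X" if "q > 0" "\<alpha> 2 = \<alpha> 1 * q"
  proof (rule continuous_modification_if_increments_quadratic)
    \<comment> \<open>Division by zero would give \<open>q = 0\<close>, contrary to
      \<open>q > 0\<close>.\<close>
    have "D \<noteq> 0"
      using that by (auto simp: q_def)
    hence "3 * D * \<alpha> 2 = \<alpha> 1 * N"
      using that by (simp add: q_def)
    \<comment> \<open>\<open>m 2 * L\<close> equals 2 (\<alpha>1 N - 3 D \<alpha>2).\<close>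
    hence "L = 0"
      unfolding L_def D_def N_def by (simp add: algebra_simps)
    thus "(\<integral>\<omega>. (X \<tau> \<omega> - X (\<tau> + t) \<omega>) ^ 4 \<partial>M) \<le> C * t\<^sup>2" if "0 < t" for \<tau> t
      using C[OF that, of \<tau>] by simp
  qed
  moreover have "q = q'"
  proof -
    have "(m 2 powr (3 / 2))\<^sup>2 = m 2 powr 3"
      by (simp add: power2_eq_square flip: powr_add)
    hence "(skewness \<mu>)\<^sup>2 = (m 3)\<^sup>2 / m 2 ^ 3"
      using \<open>m 2 > 0\<close> by (simp add: skewness_def power_divide flip: m_def)
    \<comment> \<open>Both forms of the ratio differ by the common factor \<open>m 2 ^ 3\<close>. It
      cancels even when \<open>D = 0\<close>, where both quotients are 0 by convention.\<close>
    hence "12 + 4 * excess_kurtosis \<mu> - 3 * (skewness \<mu>)\<^sup>2 = N / m 2 ^ 3"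
      "6 + 3 * excess_kurtosis \<mu> - 3 * (skewness \<mu>)\<^sup>2 = 3 * D / m 2 ^ 3"
      using \<open>m 2 > 0\<close>
      by (simp_all add: excess_kurtosis_def N_def D_def field_simps power2_eq_square power3_eq_cube flip: m_def)
    thus ?thesis
      using \<open>m 2 > 0\<close> by (simp add: q_def q'_def)
  qed
  ultimately show ?thesis
    using integrable_fourth_power_increment
    unfolding Let_def m_def[symmetric] q'_def[symmetric] N_def[symmetric] D_def[symmetric] q_def[symmetric] L_def[symmetric]
    by blast
qed

end
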